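(* Let $\mathfrak g=\mathfrak{so}_{n+4}$ be of type $\mathsf B$ ($n\geq 3$ odd) or $\mathsf D$ ($n\ge 4$ even), so that $\mathfrak g_{-1}\simeq\mathbb C^2\otimes\mathbb C^n$, and let $q$ be the $G_0^{\mathrm{ss}}$-invariant quartic form on $\mathfrak g_{-1}$ and $q^n$ the induced quartic form on $\Lambda^n_0\mathfrak g_{-1}$ defined in the context. Then $[q^n]\in\mathbb P R_4$ is well-defined; that is, the $G_0^{\mathrm{ss}}$-invariant quartic $q^n$ on $\Lambda^n_0\mathfrak g_{-1}$ has nonzero class in $R_4=\left(S^4(\Lambda^n_0\mathfrak g_{-1})^*/I_4\right)^{G_0^{\mathrm{ss}}}$ (equivalently, it does not vanish identically on the affine cone over $\mathrm{LGr}(\mathfrak g_{-1})$).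
   Context: $\mathbb C^2$ carries a volume (symplectic) form $\epsilon$ and $\mathbb C^n$ a non-degenerate symmetric bilinear form $\langle\cdot,\cdot\rangle$. In the contact grading $\mathfrak{so}_{n+4}=\mathfrak g_{-2}\oplus\mathfrak g_{-1}\oplus\mathfrak g_0\oplus\mathfrak g_1\oplus\mathfrak g_2$ one has $\mathfrak g_0=\mathfrak{gl}_2\oplus\mathfrak{so}_n$, $\dim\mathfrak g_{-2}=1$, $\mathfrak g_{-1}=\mathbb C^2\otimes\mathbb C^n$, with (after trivialising $\mathfrak g_{-2}\simeq\mathbb C$) symplectic form $\omega(\xi\otimes v,\eta\otimes w)=\epsilon(\xi,\eta)\langle v,w\rangle$ up to scale. $G_0^{\mathrm{ss}}$ is the semisimple group with Lie algebra $\mathfrak{sl}_2\oplus\mathfrak{so}_n$ acting on $\mathfrak g_{-1}$ as the image of $\mathrm{SL}_2\times\mathrm{SO}_n$. $\Lambda^n_0\mathfrak g_{-1}$ is the kernel of the contraction $\Lambda^n\mathfrak g_{-1}\to\Lambda^{n-2}\mathfrak g_{-1}$ with $\omega$; $\mathrm{LGr}(\mathfrak g_{-1})\subset\mathbb P\Lambda^n_0\mathfrak g_{-1}$ is the Lagrangian Grassmannian in its Plücker embedding $L\mapsto\Lambda^nL$, with homogeneous ideal $I=\bigoplus_dI_d\subset S^\bullet(\Lambda^n_0\mathfrak g_{-1})^*$; $R=\bigoplus_dR_d=(S^\bullet(\Lambda^n_0\mathfrak g_{-1})^*/I)^{G_0^{\mathrm{ss}}}$, graded by the standard degree $d$. The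 quartic form $q\in S^4\mathfrak g_{-1}^*$ is given by the symmetrisation over the four arguments of $$(\xi_1\otimes e_1,\ \xi_2\otimes e_2,\ \xi_3\otimes e_3,\ \xi_4\otimes e_4)\mapsto\epsilon(\xi_1,\xi_2)\,\epsilon(\xi_3,\xi_4)\big[\langle e_1,e_3\rangle\langle e_2,e_4\rangle-\langle e_2,e_3\rangle\langle e_1,e_4\rangle\big].$$ Equivalently, up to a nonzero scalar, $q(\alpha\otimes a+\beta\otimes b)=\langle a,a\rangle\langle b,b\rangle-\langle a,b\rangle^2$ for a basis $\alpha,\beta$ of $\mathbb C^2$ and $a,b\in\mathbb C^n$. $q^n\in S^nS^4\mathfrak g_{-1}^*$ is sent by the natural map $S^nS^4\mathfrak g_{-1}^*\to S^4\Lambda^n\mathfrak g_{-1}^*$ to a quartic form on $\Lambda^n\mathfrak g_{-1}$ (then restricted to $\Lambda^n_0\mathfrak g_{-1}$), also denoted $q^n$. Explicitly, up to a nonzero scalar, the associated symmetric $4$-linear form is $$(v^{1}_1\wedge\dots\wedge v^{1}_n,\ \dots,\ v^{4}_1\wedge\dots\wedge v^{4}_n)\mapsto\sum_{\sigma_1,\dots,\sigma_4\in S_n}\mathrm{sgn}(\sigma_1\sigma_2\sigma_3\sigma_4)\prod_{i=1}^nq\big(v^{1}_{\sigma_1(i)},v^{2}_{\sigma_2(i)},v^{3}_{\sigma_3(i)},v^{4}_{\sigma_4(i)}\big),$$ where $q(\cdot,\cdot,\cdot,\cdot)$ is the symmetric $4$-linear form (polarisation) of the quartic $q$. *)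

theory Defs
  imports "HOL-Analysis.Analysis" "HOL-Library.Function_Algebras" "HOL-Combinatorics.Permutations"
begin

section \<open>Forms on coordinate spaces\<close>

definition bilinear_form :: "(complex^'a \<Rightarrow> complex^'a \<Rightarrow> complex) \<Rightarrow> bool" where
  "bilinear_form b \<longleftrightarrow>
     (\<forall>x. Vector_Spaces.linear (*s) (*) (b x)) \<and>
     (\<forall>y. Vector_Spaces.linear (*s) (*) (\<lambda>x. b x y))"

definition volume_form :: "(complex^2 \<Rightarrow> complex^2 \<Rightarrow> complex) \<Rightarrow> bool" where
  "volume_form eps \<longleftrightarrow>
     bilinear_form eps \<and> (\<forall>x. eps x x = 0) \<and> (\<exists>x y. eps x y \<noteq> 0)"

definition nondegenerate_symmetric_form :: "(complex^'a \<Rightarrow> complex^'a \<Rightarrow> complex) \<Rightarrow> bool" where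
  "nondegenerate_symmetric_form b \<longleftrightarrow>
     bilinear_form b \<and> (\<forall>x y. b x y = b y x) \<and> (\<forall>x. (\<forall>y. b x y = 0) \<longrightarrow> x = 0)"


section \<open>Exterior powers\<close>

text \<open>
  A tensor over \<open>\<complex>\<^sup>b\<close> is given by its coordinates on words in the basis; the coordinates of
  a tensor of degree \<open>k\<close> vanish on words of length other than \<open>k\<close>. In characteristic 0
  the exterior power is the space of alternating tensors, with
  \<open>v\<^sub>1 \<and> \<dots> \<and> v\<^sub>k = \<Sum>\<sigma>. sgn \<sigma> v\<^bsub>\<sigma> 1\<^esub> \<otimes> \<dots> \<otimes> v\<^bsub>\<sigma> k\<^esub>\<close>.
\<close>

type_synonym 'b tensor = "'b list \<Rightarrow> complex"

definition scale_tensor :: "complex \<Rightarrow> 'b tensor \<Rightarrow> 'b tensor" where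
  "scale_tensor c T = (\<lambda>l. c * T l)"

interpretation tensor: vector_space scale_tensor
  by unfold_locales (auto simp: scale_tensor_def fun_eq_iff algebra_simps)

definition wedge :: "nat \<Rightarrow> (nat \<Rightarrow> complex^'b) \<Rightarrow> 'b tensor" where
  "wedge k v = (\<lambda>l. if length l = k
     then (\<Sum>\<sigma> | \<sigma> permutes {..<k}. of_int (sign \<sigma>) * (\<Prod>i<k. v (\<sigma> i) $ (l ! i))) else 0)"

definition ext_power :: "nat \<Rightarrow> (complex^'b) set \<Rightarrow> 'b tensor set" where
  "ext_power k U = tensor.span {wedge k v | v. v ` {..<k} \<subseteq> U}"

text \<open>
  With the above normalisation of the wedge product, \<open>contraction \<omega> (v\<^sub>1 \<and> \<dots> \<and> v\<^sub>k)\<close> is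
  \<open>2 \<Sum>i<j. \<plusminus> \<omega> v\<^sub>i v\<^sub>j v\<^sub>1 \<and> \<dots> \<and> v\<^sub>k\<close> (\<open>v\<^sub>i\<close> and \<open>v\<^sub>j\<close> omitted).
\<close>

definition contraction ::
    "(complex^'b \<Rightarrow> complex^'b \<Rightarrow> complex) \<Rightarrow> 'b tensor \<Rightarrow> 'b::finite tensor" where
  "contraction w T =
     (\<lambda>l. \<Sum>a\<in>UNIV. \<Sum>b\<in>UNIV. w (axis a 1) (axis b 1) * T (a # b # l))"

definition primitive_ext_power ::
    "nat \<Rightarrow> (complex^'b \<Rightarrow> complex^'b \<Rightarrow> complex) \<Rightarrow> 'b::finite tensor set" where
  "primitive_ext_power k w = {T \<in> ext_power k UNIV. contraction w T = 0}"

text \<open>The action of a linear map on tensors, \<open>g \<otimes> \<dots> \<otimes> g\<close> in each degree.\<close>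

definition tensor_map :: "complex^'b^'b \<Rightarrow> 'b tensor \<Rightarrow> 'b tensor" where
  "tensor_map g T =
     (\<lambda>l. \<Sum>m | length m = length l. (\<Prod>i<length l. g $ (l ! i) $ (m ! i)) * T m)"


section \<open>Homogeneous polynomials and coordinate rings of cones\<close>

definition dual_space :: "'b tensor set \<Rightarrow> ('b tensor \<Rightarrow> complex) set" where
  "dual_space W = {\<phi>. (\<forall>x\<in>W. \<forall>y\<in>W. \<phi> (x + y) = \<phi> x + \<phi> y) \<and>
                      (\<forall>c. \<forall>x\<in>W. \<phi> (scale_tensor c x) = c * \<phi> x)}"

text \<open>
  \<open>S\<^sup>d W\<^sup>*\<close> as the space of homogeneous polynomial functions of degree \<open>d\<close> on \<open>W\<close>.
\<close>

definition forms :: "nat \<Rightarrow> 'b tensor set \<Rightarrow> ('b tensor \<Rightarrow> complex) set" where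
  "forms d W = {f \<in> extensional W.
     \<exists>(N::nat) c \<phi>. (\<forall>j<N. \<forall>i<d. \<phi> j i \<in> dual_space W) \<and>
       (\<forall>x\<in>W. f x = (\<Sum>j<N. c j * (\<Prod>i<d. \<phi> j i x)))}"

text \<open>Here \<open>X \<subseteq> W\<close> is the affine cone over a projective variety in \<open>\<bbbP>W\<close>.\<close>

definition vanishing_forms ::
    "nat \<Rightarrow> 'b tensor set \<Rightarrow> 'b tensor set \<Rightarrow> ('b tensor \<Rightarrow> complex) set" where
  "vanishing_forms d W X = {f \<in> forms d W. \<forall>x\<in>X. f x = 0}"

definition congruent_forms ::
    "nat \<Rightarrow> 'b tensor set \<Rightarrow> 'b tensor set \<Rightarrow> (('b tensor \<Rightarrow> complex) \<times> ('b tensor \<Rightarrow> complex)) set"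
  where
  "congruent_forms d W X = {(f, h). f \<in> forms d W \<and> h \<in> forms d W \<and>
     (\<lambda>x\<in>W. f x - h x) \<in> vanishing_forms d W X}"

definition form_action ::
    "'b tensor set \<Rightarrow> complex^'b^'b \<Rightarrow> ('b tensor \<Rightarrow> complex) \<Rightarrow> ('b::finite tensor \<Rightarrow> complex)"
  where
  "form_action W g f = (\<lambda>x\<in>W. f (tensor_map (matrix_inv g) x))"

definition invariant_classes ::
    "nat \<Rightarrow> 'b tensor set \<Rightarrow> 'b tensor set \<Rightarrow> (complex^'b^'b) set \<Rightarrow> ('b::finite tensor \<Rightarrow> complex) set set"
  where
  "invariant_classes d W X G =
     {C \<in> forms d W // congruent_forms d W X. \<forall>g\<in>G. form_action W g ` C = C}"


section \<open>The space \<open>\<complex>\<^sup>2 \<otimes> \<complex>\<^sup>n\<close>\<close>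

definition tensor_vec :: "complex^2 \<Rightarrow> complex^'n \<Rightarrow> complex^(2 \<times> 'n)" where
  "tensor_vec xi v = (\<chi> p. xi $ fst p * v $ snd p)"

definition kronecker :: "complex^2^2 \<Rightarrow> complex^'n^'n \<Rightarrow> complex^(2 \<times> 'n)^(2 \<times> 'n)" where
  "kronecker A B = (\<chi> p r. A $ fst p $ fst r * B $ snd p $ snd r)"

definition special_orthogonal ::
    "(complex^'n \<Rightarrow> complex^'n \<Rightarrow> complex) \<Rightarrow> (complex^'n^'n) set" where
  "special_orthogonal ip = {B. det B = 1 \<and> (\<forall>x y. ip (B *v x) (B *v y) = ip x y)}"

definition G0ss ::
    "(complex^'n \<Rightarrow> complex^'n \<Rightarrow> complex) \<Rightarrow> (complex^(2 \<times> 'n)^(2 \<times> 'n)) set" where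
  "G0ss ip = {kronecker A B | A B. det A = 1 \<and> B \<in> special_orthogonal ip}"

definition omega ::
    "(complex^2 \<Rightarrow> complex^2 \<Rightarrow> complex) \<Rightarrow> (complex^'n \<Rightarrow> complex^'n \<Rightarrow> complex)
      \<Rightarrow> complex^(2 \<times> 'n) \<Rightarrow> complex^(2 \<times> 'n) \<Rightarrow> complex" where
  "omega eps ip x y = (\<Sum>p\<in>UNIV. \<Sum>r\<in>UNIV. x $ p * y $ r *
     (eps (axis (fst p) 1) (axis (fst r) 1) * ip (axis (snd p) 1) (axis (snd r) 1)))"

text \<open>
  The 4-linear form whose symmetrisation is \<open>q\<close>, extended from pure tensors (see
  \<open>q_unsym_tensor_vec\<close> below).
\<close>

definition q_unsym ::
    "(complex^2 \<Rightarrow> complex^2 \<Rightarrow> complex) \<Rightarrow> (complex^'n \<Rightarrow> complex^'n \<Rightarrow> complex)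
      \<Rightarrow> complex^(2 \<times> 'n) \<Rightarrow> complex^(2 \<times> 'n) \<Rightarrow> complex^(2 \<times> 'n) \<Rightarrow> complex^(2 \<times> 'n) \<Rightarrow> complex" where
  "q_unsym eps ip x1 x2 x3 x4 =
     (\<Sum>p1\<in>UNIV. \<Sum>p2\<in>UNIV. \<Sum>p3\<in>UNIV. \<Sum>p4\<in>UNIV. x1 $ p1 * x2 $ p2 * x3 $ p3 * x4 $ p4 *
       (eps (axis (fst p1) 1) (axis (fst p2) 1) * eps (axis (fst p3) 1) (axis (fst p4) 1) *
        (ip (axis (snd p1) 1) (axis (snd p3) 1) * ip (axis (snd p2) 1) (axis (snd p4) 1) -
         ip (axis (snd p2) 1) (axis (snd p3) 1) * ip (axis (snd p1) 1) (axis (snd p4) 1))))"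

definition symmetrise4 :: "('v \<Rightarrow> 'v \<Rightarrow> 'v \<Rightarrow> 'v \<Rightarrow> complex) \<Rightarrow> 'v \<Rightarrow> 'v \<Rightarrow> 'v \<Rightarrow> 'v \<Rightarrow> complex" where
  "symmetrise4 F x1 x2 x3 x4 = (\<Sum>\<pi> | \<pi> permutes {..<4::nat}.
     F ([x1, x2, x3, x4] ! \<pi> 0) ([x1, x2, x3, x4] ! \<pi> 1)
       ([x1, x2, x3, x4] ! \<pi> 2) ([x1, x2, x3, x4] ! \<pi> 3)) / fact 4"

definition q_form ::
    "(complex^2 \<Rightarrow> complex^2 \<Rightarrow> complex) \<Rightarrow> (complex^'n \<Rightarrow> complex^'n \<Rightarrow> complex)
      \<Rightarrow> complex^(2 \<times> 'n) \<Rightarrow> complex^(2 \<times> 'n) \<Rightarrow> complex^(2 \<times> 'n) \<Rightarrow> complex^(2 \<times> 'n) \<Rightarrow> complex" where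
  "q_form eps ip = symmetrise4 (q_unsym eps ip)"

text \<open>
  The image of \<open>F\<^sup>k\<close> under \<open>S\<^sup>k S\<^sup>4 V\<^sup>* \<rightarrow> S\<^sup>4 \<Lambda>\<^sup>k V\<^sup>*\<close>, as a symmetric 4-linear form: factor
  \<open>i\<close> of \<open>F \<otimes> \<dots> \<otimes> F\<close> is applied to the \<open>i\<close>-th tensor slots of the four arguments. Its
  values on decomposable arguments are computed in \<open>power_form_wedge\<close> below.
\<close>

definition power_form ::
    "nat \<Rightarrow> (complex^'b \<Rightarrow> complex^'b \<Rightarrow> complex^'b \<Rightarrow> complex^'b \<Rightarrow> complex)
      \<Rightarrow> 'b tensor \<Rightarrow> 'b tensor \<Rightarrow> 'b tensor \<Rightarrow> 'b::finite tensor \<Rightarrow> complex" where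
  "power_form k F T1 T2 T3 T4 =
     (\<Sum>l1 | length l1 = k. \<Sum>l2 | length l2 = k. \<Sum>l3 | length l3 = k. \<Sum>l4 | length l4 = k.
       (\<Prod>i<k. F (axis (l1 ! i) 1) (axis (l2 ! i) 1) (axis (l3 ! i) 1) (axis (l4 ! i) 1)) *
       (T1 l1 * T2 l2 * T3 l3 * T4 l4))"

definition Lambda0 ::
    "(complex^2 \<Rightarrow> complex^2 \<Rightarrow> complex) \<Rightarrow> (complex^'n \<Rightarrow> complex^'n \<Rightarrow> complex)
      \<Rightarrow> (2 \<times> 'n) tensor set" where
  "Lambda0 eps ip = primitive_ext_power CARD('n) (omega eps ip)"

definition LGr ::
    "(complex^2 \<Rightarrow> complex^2 \<Rightarrow> complex) \<Rightarrow> (complex^'n \<Rightarrow> complex^'n \<Rightarrow> complex)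
      \<Rightarrow> (complex^(2 \<times> 'n)) set set" where
  "LGr eps ip = {L. vec.subspace L \<and> vec.dim L = CARD('n) \<and> (\<forall>x\<in>L. \<forall>y\<in>L. omega eps ip x y = 0)}"

definition LGr_cone ::
    "(complex^2 \<Rightarrow> complex^2 \<Rightarrow> complex) \<Rightarrow> (complex^'n \<Rightarrow> complex^'n \<Rightarrow> complex)
      \<Rightarrow> (2 \<times> 'n) tensor set" where
  "LGr_cone eps ip = (\<Union>L \<in> LGr eps ip. ext_power CARD('n) L)"

definition R_part ::
    "(complex^2 \<Rightarrow> complex^2 \<Rightarrow> complex) \<Rightarrow> (complex^'n \<Rightarrow> complex^'n \<Rightarrow> complex)
      \<Rightarrow> nat \<Rightarrow> ((2 \<times> 'n) tensor \<Rightarrow> complex) set set" where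
  "R_part eps ip d = invariant_classes d (Lambda0 eps ip) (LGr_cone eps ip) (G0ss ip)"

definition form_class ::
    "(complex^2 \<Rightarrow> complex^2 \<Rightarrow> complex) \<Rightarrow> (complex^'n \<Rightarrow> complex^'n \<Rightarrow> complex)
      \<Rightarrow> nat \<Rightarrow> ((2 \<times> 'n) tensor \<Rightarrow> complex) \<Rightarrow> ((2 \<times> 'n) tensor \<Rightarrow> complex) set" where
  "form_class eps ip d f = congruent_forms d (Lambda0 eps ip) (LGr_cone eps ip) `` {f}"

definition zero_form_class ::
    "(complex^2 \<Rightarrow> complex^2 \<Rightarrow> complex) \<Rightarrow> (complex^'n \<Rightarrow> complex^'n \<Rightarrow> complex)
      \<Rightarrow> nat \<Rightarrow> ((2 \<times> 'n) tensor \<Rightarrow> complex) set" where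
  "zero_form_class eps ip d = form_class eps ip d (\<lambda>x \<in> Lambda0 eps ip. 0)"

definition qn ::
    "(complex^2 \<Rightarrow> complex^2 \<Rightarrow> complex) \<Rightarrow> (complex^'n \<Rightarrow> complex^'n \<Rightarrow> complex)
      \<Rightarrow> (2 \<times> 'n) tensor \<Rightarrow> complex" where
  "qn eps ip = (\<lambda>x \<in> Lambda0 eps ip. power_form CARD('n) (q_form eps ip) x x x x)"


section \<open>Values on decomposable arguments\<close>

lemma bilinear_form_expand_left:
  fixes b :: "complex^'a \<Rightarrow> complex^'a \<Rightarrow> complex"
  assumes "bilinear_form b"
  shows "b x y = (\<Sum>i\<in>UNIV. x $ i * b (axis i 1) y)"
proof -
  have "Vector_Spaces.linear (*s) (*) (\<lambda>x. b x y)"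
    using assms by (auto simp: bilinear_form_def)
  note m = Vector_Spaces.linear.axioms(3)[OF this]
  have "b x y = b (\<Sum>i\<in>UNIV. x $ i *s axis i 1) y"
    by (simp only: basis_expansion)
  then show ?thesis
    by (simp only: module_hom.sum[OF m] module_hom.scale[OF m])
qed

lemma bilinear_form_expand_right:
  fixes b :: "complex^'a \<Rightarrow> complex^'a \<Rightarrow> complex"
  assumes "bilinear_form b"
  shows "b x y = (\<Sum>j\<in>UNIV. y $ j * b x (axis j 1))"
proof -
  have "bilinear_form (\<lambda>x y. b y x)"
    using assms by (auto simp: bilinear_form_def)
  from bilinear_form_expand_left[OF this] show ?thesis .
qed

lemma bilinear_form_expand:
  fixes b :: "complex^'a \<Rightarrow> complex^'a \<Rightarrow> complex"
  assumes "bilinear_form b"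
  shows "b x y = (\<Sum>i\<in>UNIV. \<Sum>j\<in>UNIV. x $ i * y $ j * b (axis i 1) (axis j 1))"
  by (subst bilinear_form_expand_left[OF assms], subst bilinear_form_expand_right[OF assms])
     (simp only: sum_distrib_left mult.assoc)

lemma sum_UNIV_prod:
  fixes f :: "'a::finite \<times> 'b::finite \<Rightarrow> 'c::comm_monoid_add"
  shows "(\<Sum>p\<in>UNIV. f p) = (\<Sum>i\<in>UNIV. \<Sum>j\<in>UNIV. f (i, j))"
  by (simp add: sum.cartesian_product flip: UNIV_Times_UNIV)

lemma omega_tensor_vec:
  assumes "bilinear_form eps" "bilinear_form ip"
  shows "omega eps ip (tensor_vec xi v) (tensor_vec eta w) = eps xi eta * ip v w"
proof -
  have "eps xi eta * ip v w = 
    (\<Sum>i\<in>UNIV. \<Sum>j\<in>UNIV. \<Sum>k\<in>UNIV. \<Sum>m\<in>UNIV. 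
      (xi $ i * eta $ j * eps (axis i 1) (axis j 1)) * (v $ k * w $ m * ip (axis k 1) (axis m 1)))"
    by (subst bilinear_form_expand[OF assms(1)], subst bilinear_form_expand[OF assms(2)])
       (simp only: sum_distrib_right, simp only: sum_distrib_left)
  also have "\<dots> = (\<Sum>i\<in>UNIV. \<Sum>k\<in>UNIV. \<Sum>j\<in>UNIV. \<Sum>m\<in>UNIV. 
      (xi $ i * eta $ j * eps (axis i 1) (axis j 1)) * (v $ k * w $ m * ip (axis k 1) (axis m 1)))"
    by (intro sum.cong refl sum.swap)
  finally show ?thesis
    by (simp add: omega_def tensor_vec_def sum_UNIV_prod mult_ac)
qed

lemma sum_lists_prod:
  fixes f :: "nat \<Rightarrow> 'b::finite \<Rightarrow> complex"
  shows "(\<Sum>l | length l = k. \<Prod>i<k. f i (l ! i)) = (\<Prod>i<k. \<Sum>a\<in>UNIV. f i a)"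
proof (induction k arbitrary: f)
  case (Suc k)
  have "{l :: 'b list. length l = Suc k} = (\<lambda>x. fst x # snd x) ` (UNIV \<times> {l. length l = k})"
    by (auto simp: length_Suc_conv image_iff)
  moreover have "inj_on (\<lambda>x. fst x # snd x) (UNIV \<times> {l :: 'b list. length l = k})"
    by (auto simp: inj_on_def)
  ultimately have "(\<Sum>l | length l = Suc k. \<Prod>i<Suc k. f i (l ! i)) =
      (\<Sum>a\<in>UNIV. \<Sum>l | length l = k. f 0 a * (\<Prod>i<k. f (Suc i) (l ! i)))"
    by (simp add: sum.reindex sum.cartesian_product case_prod_beta prod.lessThan_Suc_shift
          del: prod.lessThan_Suc)
  also have "\<dots> = (\<Sum>a\<in>UNIV. f 0 a * (\<Sum>l | length l = k. \<Prod>i<k. f (Suc i) (l ! i)))"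
    by (simp only: sum_distrib_left)
  also have "\<dots> = (\<Sum>a\<in>UNIV. f 0 a) * (\<Prod>i<k. \<Sum>a\<in>UNIV. f (Suc i) a)"
    by (simp only: Suc.IH[of "\<lambda>i. f (Suc i)"] sum_distrib_right)
  finally show ?case by (simp add: prod.lessThan_Suc_shift del: prod.lessThan_Suc)
qed simp

lemma sum_wedge_prod:
  fixes v :: "nat \<Rightarrow> complex^'b"
  shows "(\<Sum>l | length l = k. wedge k v l * (\<Prod>i<k. f i (l ! i))) =
    (\<Sum>s | s permutes {..<k}. of_int (sign s) * (\<Prod>i<k. \<Sum>a\<in>UNIV. v (s i) $ a * f i a))"
proof -
  have "(\<Sum>l | length l = k. wedge k v l * (\<Prod>i<k. f i (l ! i))) =
    (\<Sum>l | length l = k. \<Sum>s | s permutes {..<k}.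
      of_int (sign s) * (\<Prod>i<k. v (s i) $ (l ! i) * f i (l ! i)))"
    by (simp add: wedge_def sum_distrib_right prod.distrib mult.assoc)
  also have "\<dots> = (\<Sum>s | s permutes {..<k}. of_int (sign s) *
      (\<Sum>l | length l = k. \<Prod>i<k. v (s i) $ (l ! i) * f i (l ! i)))"
    by (subst sum.swap) (simp add: sum_distrib_left)
  finally show ?thesis
    by (simp only: sum_lists_prod[of "\<lambda>i a. v (s i) $ a * f i a" k for s])
qed

lemma sum_reverse4:
  "(\<Sum>a\<in>A. \<Sum>b\<in>B. \<Sum>c\<in>C. \<Sum>d\<in>D. f a b c d) = (\<Sum>d\<in>D. \<Sum>c\<in>C. \<Sum>b\<in>B. \<Sum>a\<in>A. f a b c d)"
proof -
  have "(\<Sum>b\<in>B. \<Sum>c\<in>C. \<Sum>d\<in>D. f a b c d) = (\<Sum>d\<in>D. \<Sum>c\<in>C. \<Sum>b\<in>B. f a b c d)" for a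
    by (subst sum.swap[where A = B], subst sum.swap[where A = B], subst sum.swap[where A = C]) (rule refl)
  then show ?thesis
    by (simp add: sum.swap[where A = A])
qed

lemma power_form_wedge:
  fixes F :: "complex^'b \<Rightarrow> complex^'b \<Rightarrow> complex^'b \<Rightarrow> complex^'b \<Rightarrow> complex"
  assumes F: "\<And>x1 x2 x3 x4. F x1 x2 x3 x4 = (\<Sum>a\<in>UNIV. \<Sum>b\<in>UNIV. \<Sum>c\<in>UNIV. \<Sum>d\<in>UNIV.
    x1 $ a * x2 $ b * x3 $ c * x4 $ d * F (axis a 1) (axis b 1) (axis c 1) (axis d 1))"
  shows "power_form k F (wedge k v1) (wedge k v2) (wedge k v3) (wedge k v4) =
    (\<Sum>s1 | s1 permutes {..<k}. \<Sum>s2 | s2 permutes {..<k}.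
     \<Sum>s3 | s3 permutes {..<k}. \<Sum>s4 | s4 permutes {..<k}.
      of_int (sign s1 * sign s2 * sign s3 * sign s4) *
      (\<Prod>i<k. F (v1 (s1 i)) (v2 (s2 i)) (v3 (s3 i)) (v4 (s4 i))))"
proof -
  let ?L = "{l :: 'b list. length l = k}" and ?S = "{s. s permutes {..<k}}"
  let ?e = "\<lambda>a. axis a 1 :: complex^'b"
  define G where "G a b c d = F (?e a) (?e b) (?e c) (?e d)" for a b c d
  have N: "F x1 x2 x3 x4 = (\<Sum>a\<in>UNIV. x1 $ a * (\<Sum>b\<in>UNIV. x2 $ b *
      (\<Sum>c\<in>UNIV. x3 $ c * (\<Sum>d\<in>UNIV. x4 $ d * G a b c d))))" for x1 x2 x3 x4
    by (subst F) (simp add: G_def sum_distrib_left mult.assoc)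
  have delta: "(\<Sum>b\<in>UNIV. ?e a $ b * h b) = h a" for a and h :: "'b \<Rightarrow> complex"
    by (simp add: axis_def if_distrib if_distribR sum.delta cong: if_cong)
  have lin: "F x1 x2 x3 x4 = (\<Sum>a\<in>UNIV. x1 $ a * F (?e a) x2 x3 x4)"
            "F (?e p) x2 x3 x4 = (\<Sum>a\<in>UNIV. x2 $ a * F (?e p) (?e a) x3 x4)"
            "F (?e p) (?e q) x3 x4 = (\<Sum>a\<in>UNIV. x3 $ a * F (?e p) (?e q) (?e a) x4)"
            "F (?e p) (?e q) (?e r) x4 = (\<Sum>a\<in>UNIV. x4 $ a * F (?e p) (?e q) (?e r) (?e a))"
    for x1 x2 x3 x4 p q r
    by (simp_all only: N delta)
  have p: "(\<Sum>l\<in>?L. wedge k v l * (\<Sum>s\<in>?S. c s * G s l)) = (\<Sum>s\<in>?S. c s * (\<Sum>l\<in>?L. wedge k v l * G s l))"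
    for v :: "nat \<Rightarrow> complex^'b" and c :: "(nat \<Rightarrow> nat) \<Rightarrow> complex" and G
    by (simp add: sum_distrib_left mult.left_commute) (rule sum.swap)
  have P4: "(\<Sum>l\<in>?L. wedge k v l * (\<Prod>i<k. F (?e (x i)) (?e (y i)) (?e (z i)) (?e (l ! i)))) =
      (\<Sum>s\<in>?S. of_int (sign s) * (\<Prod>i<k. F (?e (x i)) (?e (y i)) (?e (z i)) (v (s i))))" for v x y z
    by (subst sum_wedge_prod[of k v "\<lambda>i a. F (?e (x i)) (?e (y i)) (?e (z i)) (?e a)"])
       (simp only: lin(4)[symmetric])
  have P3: "(\<Sum>l\<in>?L. wedge k v l * (\<Prod>i<k. F (?e (x i)) (?e (y i)) (?e (l ! i)) (z i))) =
      (\<Sum>s\<in>?S. of_int (sign s) * (\<Prod>i<k. F (?e (x i)) (?e (y i)) (v (s i)) (z i)))" for v x y z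
    by (subst sum_wedge_prod[of k v "\<lambda>i a. F (?e (x i)) (?e (y i)) (?e a) (z i)"])
       (simp only: lin(3)[symmetric])
  have P2: "(\<Sum>l\<in>?L. wedge k v l * (\<Prod>i<k. F (?e (x i)) (?e (l ! i)) (y i) (z i))) =
      (\<Sum>s\<in>?S. of_int (sign s) * (\<Prod>i<k. F (?e (x i)) (v (s i)) (y i) (z i)))" for v x y z
    by (subst sum_wedge_prod[of k v "\<lambda>i a. F (?e (x i)) (?e a) (y i) (z i)"])
       (simp only: lin(2)[symmetric])
  have P1: "(\<Sum>l\<in>?L. wedge k v l * (\<Prod>i<k. F (?e (l ! i)) (x i) (y i) (z i))) =
      (\<Sum>s\<in>?S. of_int (sign s) * (\<Prod>i<k. F (v (s i)) (x i) (y i) (z i)))" for v x y z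
    by (subst sum_wedge_prod[of k v "\<lambda>i a. F (?e a) (x i) (y i) (z i)"])
       (simp only: lin(1)[symmetric])
  have "power_form k F (wedge k v1) (wedge k v2) (wedge k v3) (wedge k v4) =
    (\<Sum>l1\<in>?L. wedge k v1 l1 * (\<Sum>l2\<in>?L. wedge k v2 l2 * (\<Sum>l3\<in>?L. wedge k v3 l3 * (\<Sum>l4\<in>?L. wedge k v4 l4 *
       (\<Prod>i<k. F (?e (l1 ! i)) (?e (l2 ! i)) (?e (l3 ! i)) (?e (l4 ! i)))))))"
    by (simp add: power_form_def sum_distrib_left mult_ac)
  also have "\<dots> = (\<Sum>s4\<in>?S. of_int (sign s4) * (\<Sum>s3\<in>?S. of_int (sign s3) *
      (\<Sum>s2\<in>?S. of_int (sign s2) * (\<Sum>s1\<in>?S. of_int (sign s1) *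
        (\<Prod>i<k. F (v1 (s1 i)) (v2 (s2 i)) (v3 (s3 i)) (v4 (s4 i)))))))"
    by (simp only: P4 P3 P2 P1 p)
  also have "\<dots> = (\<Sum>s4\<in>?S. \<Sum>s3\<in>?S. \<Sum>s2\<in>?S. \<Sum>s1\<in>?S.
      of_int (sign s1 * sign s2 * sign s3 * sign s4) *
      (\<Prod>i<k. F (v1 (s1 i)) (v2 (s2 i)) (v3 (s3 i)) (v4 (s4 i))))"
    by (simp add: sum_distrib_left mult_ac)
  finally show ?thesis by (rule trans[OF _ sum_reverse4])
qed

definition linear_coords :: "(complex^'a \<Rightarrow> complex) \<Rightarrow> bool" where
  "linear_coords f \<longleftrightarrow> (\<forall>x. f x = (\<Sum>i\<in>UNIV. x $ i * f (axis i 1)))"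

lemma linear_coords_bilinear:
  assumes "bilinear_form b"
  shows "linear_coords (\<lambda>x. b x y)" "linear_coords (\<lambda>x. b y x)"
  unfolding linear_coords_def
  using bilinear_form_expand_left[OF assms, of _ y] bilinear_form_expand_right[OF assms, of y]
  by blast+

lemma linear_coords_simps:
  assumes f: "linear_coords f"
  shows "linear_coords (\<lambda>x. c * f x)" "linear_coords (\<lambda>x. f x * c)"
    and "linear_coords g \<Longrightarrow> linear_coords (\<lambda>x. f x - g x)"
proof -
  have e: "f x = (\<Sum>i\<in>UNIV. x $ i * f (axis i 1))" for x
    using f unfolding linear_coords_def by blast
  show "linear_coords (\<lambda>x. c * f x)" unfolding linear_coords_def
  proof
    fix x show "c * f x = (\<Sum>i\<in>UNIV. x $ i * (c * f (axis i 1)))"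
      by (subst e[of x]) (simp add: sum_distrib_left mult.left_commute)
  qed
  show "linear_coords (\<lambda>x. f x * c)" unfolding linear_coords_def
  proof
    fix x show "f x * c = (\<Sum>i\<in>UNIV. x $ i * (f (axis i 1) * c))"
      by (subst e[of x]) (simp add: sum_distrib_right mult.assoc)
  qed
  assume g: "linear_coords g"
  have h: "g x = (\<Sum>i\<in>UNIV. x $ i * g (axis i 1))" for x
    using g unfolding linear_coords_def by blast
  show "linear_coords (\<lambda>x. f x - g x)" unfolding linear_coords_def
  proof
    fix x show "f x - g x = (\<Sum>i\<in>UNIV. x $ i * (f (axis i 1) - g (axis i 1)))"
      by (subst e[of x], subst h[of x]) (simp add: sum_subtractf right_diff_distrib)
  qed
qed

lemma q_unsym_tensor_vec:
  assumes "bilinear_form eps" "bilinear_form ip"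
  shows "q_unsym eps ip (tensor_vec xi1 e1) (tensor_vec xi2 e2) (tensor_vec xi3 e3) (tensor_vec xi4 e4) =
    eps xi1 xi2 * eps xi3 xi4 * (ip e1 e3 * ip e2 e4 - ip e2 e3 * ip e1 e4)"
proof -
  have peel: "(\<Sum>p\<in>UNIV. xi $ fst p * v $ snd p * (f (axis (fst p) 1) * g (axis (snd p) 1))) = f xi * g v"
    if "linear_coords f" "linear_coords g" 
    for xi :: "complex^2" and v :: "complex^'a" and f g :: "_ \<Rightarrow> complex"
  proof -
    have "f xi * g v = (\<Sum>i\<in>UNIV. xi $ i * f (axis i 1)) * (\<Sum>i\<in>UNIV. v $ i * g (axis i 1))"
      by (rule arg_cong2[of _ _ _ _ "(*)"]; use that in \<open>unfold linear_coords_def, blast\<close>)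
    then show ?thesis by (simp only: sum_product) (simp add: sum_UNIV_prod mult_ac)
  qed
  note lin = linear_coords_bilinear[OF assms(1)] linear_coords_bilinear[OF assms(2)] linear_coords_simps
  define K where "K = (\<lambda>x1 v1 x2 v2 x3 v3 x4 v4. 
     (eps x1 x2 * eps x3 x4 * (ip v1 v3 * ip v2 v4 - ip v2 v3 * ip v1 v4)))"
  have k1: "(\<Sum>p\<in>UNIV. xi $ fst p * v $ snd p * K (axis (fst p) 1) (axis (snd p) 1) x2 v2 x3 v3 x4 v4) = K xi v x2 v2 x3 v3 x4 v4"
    for xi v x2 v2 x3 v3 x4 v4
    unfolding K_def
    by (rule peel[of "\<lambda>x. eps x x2 * eps x3 x4" "\<lambda>v. ip v v3 * ip v2 v4 - ip v2 v3 * ip v v4"]) (intro lin)+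
  have k2: "(\<Sum>p\<in>UNIV. xi $ fst p * v $ snd p * K x1 v1 (axis (fst p) 1) (axis (snd p) 1) x3 v3 x4 v4) = K x1 v1 xi v x3 v3 x4 v4"
    for xi v x1 v1 x3 v3 x4 v4
    unfolding K_def
    by (rule peel[of "\<lambda>x. eps x1 x * eps x3 x4" "\<lambda>v. ip v1 v3 * ip v v4 - ip v v3 * ip v1 v4"]) (intro lin)+
  have k3: "(\<Sum>p\<in>UNIV. xi $ fst p * v $ snd p * K x1 v1 x2 v2 (axis (fst p) 1) (axis (snd p) 1) x4 v4) = K x1 v1 x2 v2 xi v x4 v4"
    for xi v x1 v1 x2 v2 x4 v4
    unfolding K_def
    by (rule peel[of "\<lambda>x. eps x1 x2 * eps x x4" "\<lambda>v. ip v1 v * ip v2 v4 - ip v2 v * ip v1 v4"]) (intro lin)+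
  have k4: "(\<Sum>p\<in>UNIV. xi $ fst p * v $ snd p * K x1 v1 x2 v2 x3 v3 (axis (fst p) 1) (axis (snd p) 1)) = K x1 v1 x2 v2 x3 v3 xi v"
    for xi v x1 v1 x2 v2 x3 v3
    unfolding K_def
    by (rule peel[of "\<lambda>x. eps x1 x2 * eps x3 x" "\<lambda>v. ip v1 v3 * ip v2 v - ip v2 v3 * ip v1 v"]) (intro lin)+
  have "q_unsym eps ip (tensor_vec xi1 e1) (tensor_vec xi2 e2) (tensor_vec xi3 e3) (tensor_vec xi4 e4) =
    (\<Sum>p1\<in>UNIV. xi1 $ fst p1 * e1 $ snd p1 * (\<Sum>p2\<in>UNIV. xi2 $ fst p2 * e2 $ snd p2 *
    (\<Sum>p3\<in>UNIV. xi3 $ fst p3 * e3 $ snd p3 * (\<Sum>p4\<in>UNIV. xi4 $ fst p4 * e4 $ snd p4 *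
      K (axis (fst p1) 1) (axis (snd p1) 1) (axis (fst p2) 1) (axis (snd p2) 1) 
        (axis (fst p3) 1) (axis (snd p3) 1) (axis (fst p4) 1) (axis (snd p4) 1)))))"
    by (simp add: q_unsym_def K_def tensor_vec_def sum_distrib_left mult.assoc)
  also have "\<dots> = K xi1 e1 xi2 e2 xi3 e3 xi4 e4"
    by (simp only: k1 k2 k3 k4)
  finally show ?thesis by (simp add: K_def)
qed

lemma q_unsym_add:
  "q_unsym eps ip (x + y) x2 x3 x4 = q_unsym eps ip x x2 x3 x4 + q_unsym eps ip y x2 x3 x4"
  "q_unsym eps ip x1 (x + y) x3 x4 = q_unsym eps ip x1 x x3 x4 + q_unsym eps ip x1 y x3 x4"
  "q_unsym eps ip x1 x2 (x + y) x4 = q_unsym eps ip x1 x2 x x4 + q_unsym eps ip x1 x2 y x4"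
  "q_unsym eps ip x1 x2 x3 (x + y) = q_unsym eps ip x1 x2 x3 x + q_unsym eps ip x1 x2 x3 y"
  by (simp_all add: q_unsym_def distrib_left distrib_right sum.distrib)

lemma q_form_diagonal:
  assumes "volume_form eps" "nondegenerate_symmetric_form ip"
    and "x = tensor_vec \<alpha> a + tensor_vec \<beta> b"
  shows "q_form eps ip x x x x = 4 * (eps \<alpha> \<beta>)\<^sup>2 * (ip a a * ip b b - (ip a b)\<^sup>2)"
proof -
  have b: "bilinear_form eps" "bilinear_form ip" and z: "\<And>x. eps x x = 0"
    and sym: "ip b a = ip a b"
    using assms by (auto simp: volume_form_def nondegenerate_symmetric_form_def)
  have "eps (\<alpha> + \<beta>) (\<alpha> + \<beta>) = eps \<alpha> \<alpha> + eps \<alpha> \<beta> + eps \<beta> \<alpha> + eps \<beta> \<beta>"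
    by (simp add: bilinear_form_expand[OF b(1), of "_ + _"] bilinear_form_expand[OF b(1), of \<alpha>]
        bilinear_form_expand[OF b(1), of \<beta>] algebra_simps sum.distrib)
  then have alt: "eps \<beta> \<alpha> = - eps \<alpha> \<beta>"
    by (simp add: z add_eq_0_iff)
  have n: "[x, x, x, x] ! i = x" if "i < 4" for i
    using that by (auto simp: less_Suc_eq numeral_eq_Suc)
  have "q_form eps ip x x x x = q_unsym eps ip x x x x"
  proof -
    have "(\<Sum>\<pi> | \<pi> permutes {..<4::nat}. q_unsym eps ip ([x, x, x, x] ! \<pi> 0) ([x, x, x, x] ! \<pi> 1)
       ([x, x, x, x] ! \<pi> 2) ([x, x, x, x] ! \<pi> 3)) = (\<Sum>\<pi> | \<pi> permutes {..<4::nat}. q_unsym eps ip x x x x)"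
    proof (intro sum.cong refl)
      fix \<pi> :: "nat \<Rightarrow> nat" assume "\<pi> \<in> {\<pi>. \<pi> permutes {..<4}}"
      then have "\<pi> i < 4" if "i < 4" for i
        using that permutes_in_image[of \<pi> "{..<4}" i] by simp
      then show "q_unsym eps ip ([x, x, x, x] ! \<pi> 0) ([x, x, x, x] ! \<pi> 1)
       ([x, x, x, x] ! \<pi> 2) ([x, x, x, x] ! \<pi> 3) = q_unsym eps ip x x x x"
        by (simp add: n)
    qed
    then show ?thesis
      by (simp add: q_form_def symmetrise4_def card_permutations[of "{..<4::nat}" 4])
  qed
  then show ?thesis
    by (simp add: assms(3) q_unsym_add q_unsym_tensor_vec[OF b] z alt sym power2_eq_square algebra_simps)
qed

end

theory Submission
  imports Defs
begin

text \<open>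
  Restricted to the exterior power of a Lagrangian subspace, \<open>q\<^sup>n\<close> is (up to \<open>n!\<close>) Cayley's first
  hyperdeterminant of the quartic \<open>q\<bar>L\<close>. Take an orthonormal basis \<open>e\<^sub>i\<close> of \<open>\<complex>\<^sup>n\<close> and pairwise
  independent \<open>\<xi>\<^sub>i = \<alpha> + i \<beta>\<close> in \<open>\<complex>\<^sup>2\<close>; the vectors \<open>v\<^sub>i = \<xi>\<^sub>i \<otimes> e\<^sub>i\<close> span a Lagrangian subspace, and there
  \<open>q\<close> is proportional to \<open>\<Sum>i<j. (i - j)\<^sup>2 x\<^sub>i\<^sup>2 x\<^sub>j\<^sup>2\<close>. The hyperdeterminant of such a form has no cancellation:
  if the index quadruple \<open>(\<sigma>\<^sub>1 i, \<sigma>\<^sub>2 i, \<sigma>\<^sub>3 i, \<sigma>\<^sub>4 i)\<close> consists of two distinct pairs for every \<open>i\<close>, then the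
  four signs multiply to 1. Hence it is a sum of nonnegative terms, one of which is positive.
\<close>

section \<open>Hyperdeterminants of forms in squares\<close>

text \<open>These are the index quadruples that occur when a monomial \<open>x_a^2 x_b^2\<close>
  with distinct indices is polarised.\<close>

definition paired :: "'a \<Rightarrow> 'a \<Rightarrow> 'a \<Rightarrow> 'a \<Rightarrow> bool" where
  "paired a b c d \<longleftrightarrow>
     (a = b \<and> c = d \<and> a \<noteq> c) \<or> (a = c \<and> b = d \<and> a \<noteq> b) \<or> (a = d \<and> b = c \<and> a \<noteq> b)"

lemma sign_paired_permutes_id:
  assumes fin: "finite S"
    and p: "t2 permutes S" "t3 permutes S" "t4 permutes S"
    and paired: "\<And>i. i \<in> S \<Longrightarrow> paired i (t2 i) (t3 i) (t4 i)"
  shows "sign t2 * sign t3 * sign t4 = 1"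
proof -
  txt \<open>
    The fixed point sets of \<open>t2\<close>, \<open>t3\<close>, \<open>t4\<close> partition \<open>S\<close> and are invariant under all three maps; on
    each of them the two nontrivial maps agree, so that \<open>t2 \<circ> t3 \<circ> t4\<close> is a square.
  \<close>
  define \<rho> where "\<rho> i = (if t2 i = i then t3 i else t2 i)" for i
  have inj: "t2 i = t2 j \<longleftrightarrow> i = j" "t3 i = t3 j \<longleftrightarrow> i = j" "t4 i = t4 j \<longleftrightarrow> i = j" for i j
    using p[THEN permutes_inj] by (auto dest: injD)
  have S: "t2 i \<in> S" "t3 i \<in> S" "t4 i \<in> S" if "i \<in> S" for i
    using that p by (auto simp: permutes_in_image)
  have out: "t2 i = i" "t3 i = i" "t4 i = i" if "i \<notin> S" for i
    using that p by (auto simp: permutes_not_in)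
  \<comment> \<open>By injectivity neither \<open>t3\<close> nor \<open>t4\<close> can fix the point
    \<open>t3 i = t4 i\<close>, so the pairing at that point leaves only \<open>t2\<close>. The next
    two facts follow in the same way.\<close>
  have fix2: "t3 i \<noteq> i \<and> t4 i = t3 i \<and> t2 (t3 i) = t3 i" if "i \<in> S" "t2 i = i" for i
    using paired[OF that(1)] paired[OF S(2)[OF that(1)]] that(2) inj unfolding paired_def by metis
  have fix3: "t2 i \<noteq> i \<and> t4 i = t2 i \<and> t3 (t2 i) = t2 i" if "i \<in> S" "t3 i = i" for i
    using paired[OF that(1)] paired[OF S(1)[OF that(1)]] that(2) inj unfolding paired_def by metis
  have fix4: "t2 i \<noteq> i \<and> t3 i = t2 i \<and> t4 (t2 i) = t2 i" if "i \<in> S" "t4 i = i" for i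
    using paired[OF that(1)] paired[OF S(1)[OF that(1)]] that(2) inj unfolding paired_def by metis
  have one: "t2 i = i \<or> t3 i = i \<or> t4 i = i" for i
    using paired[of i] out[of i] unfolding paired_def by metis
  have "\<rho> permutes S"
  proof (rule bij_imp_permutes)
    have "inj_on \<rho> S"
    proof (rule inj_onI)
      fix i j assume "i \<in> S" "j \<in> S" "\<rho> i = \<rho> j"
      then show "i = j"
        using fix2[of i] fix2[of j] inj unfolding \<rho>_def by (metis (full_types))
    qed
    moreover have "\<rho> ` S \<subseteq> S"
      using S by (auto simp: \<rho>_def)
    ultimately show "bij_betw \<rho> S S"
      using fin by (simp add: bij_betw_def endo_inj_surj)
  qed (simp add: \<rho>_def out)
  moreover have "t2 \<circ> t3 \<circ> t4 = \<rho> \<circ> \<rho>"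
  proof
    fix i show "(t2 \<circ> t3 \<circ> t4) i = (\<rho> \<circ> \<rho>) i"
    proof (cases "i \<in> S")
      case True
      consider "t2 i = i" | "t3 i = i" | "t4 i = i" using one by blast
      then show ?thesis
      proof cases
        case 1
        with True fix2[of i] fix2[of "t3 i"] S show ?thesis by (simp add: \<rho>_def)
      next
        case 2
        with True fix3[of i] S show ?thesis by (simp add: \<rho>_def inj)
      next
        case 3
        with True fix4[of i] S show ?thesis by (simp add: \<rho>_def inj)
      qed
    qed (simp add: \<rho>_def out)
  qed
  moreover have "permutation t2" "permutation t3" "permutation t4"
    using p fin by (auto simp: permutation_permutes)
  ultimately have "sign t2 * sign t3 * sign t4 = sign \<rho> * sign \<rho>"
    using fin by (metis permutation_compose permutation_permutes sign_compose)
  then show ?thesis by simp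
qed

text \<open>Composing with \<open>inv s1\<close> on the right reduces to the case where the first
  permutation is the identity. This brings in three factors \<open>sign s1\<close>, which amount to
  the single one in the claim because signs square to 1.\<close>

lemma sign_paired_permutes:
  assumes fin: "finite S"
    and p: "s1 permutes S" "s2 permutes S" "s3 permutes S" "s4 permutes S"
    and paired: "\<And>i. i \<in> S \<Longrightarrow> paired (s1 i) (s2 i) (s3 i) (s4 i)"
  shows "sign s1 * sign s2 * sign s3 * sign s4 = 1"
proof -
  let ?t = "\<lambda>s. s \<circ> inv s1"
  have perm: "permutation s" if "s permutes S" for s :: "'a \<Rightarrow> 'a"
    using that fin by (auto simp: permutation_permutes)
  have "sign (?t s2) * sign (?t s3) * sign (?t s4) = 1"
  proof (rule sign_paired_permutes_id[OF fin])
    fix i assume "i \<in> S"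
    then have "inv s1 i \<in> S"
      using p(1) by (simp add: permutes_in_image permutes_inv)
    from paired[OF this] show "paired i (?t s2 i) (?t s3 i) (?t s4 i)"
      using p(1) by (simp add: permutes_inverses)
  qed (use p in \<open>auto intro: permutes_compose permutes_inv\<close>)
  moreover have "sign (?t s) = sign s * sign s1" if "s permutes S" for s
    using that p(1) by (simp add: sign_compose sign_inverse perm permutation_inverse)
  moreover have "sign s1 * (sign s1 * x) = x" for x
    by (simp flip: mult.assoc)
  ultimately show ?thesis
    using p by (simp add: ac_simps)
qed

text \<open>The cyclic shift does it; on a single index it would have a fixed point. It supplies the
  strictly positive summand of the hyperdeterminant.\<close>

lemma fixpoint_free_permutation:
  assumes "2 \<le> k"
  obtains c :: "nat \<Rightarrow> nat" where "c permutes {..<k}" "\<And>i. i < k \<Longrightarrow> c i \<noteq> i"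
proof -
  define c where "c i = (if i < k then if Suc i = k then 0 else Suc i else i)" for i
  have "inj_on c {..<k}"
    by (auto simp: inj_on_def c_def split: if_splits)
  moreover have "c ` {..<k} \<subseteq> {..<k}"
    using assms by (auto simp: c_def)
  ultimately have "bij_betw c {..<k} {..<k}"
    by (simp add: bij_betw_def endo_inj_surj)
  then have "c permutes {..<k}"
    by (rule bij_imp_permutes) (simp add: c_def)
  moreover have "c i \<noteq> i" if "i < k" for i
    using that assms by (auto simp: c_def)
  ultimately show thesis by (rule that)
qed

text \<open>A summand with a vanishing factor is zero, and every other one has sign product 1 by
  \<open>sign_paired_permutes\<close>, so nothing cancels. Strict positivity then comes from one
  explicit summand.\<close>

lemma hyperdeterminant_pos:
  fixes r :: "nat \<Rightarrow> nat \<Rightarrow> nat \<Rightarrow> nat \<Rightarrow> real"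
  assumes k: "2 \<le> k"
    and nonneg: "\<And>a b c d. 0 \<le> r a b c d"
    and paired: "\<And>a b c d. r a b c d \<noteq> 0 \<Longrightarrow> paired a b c d"
    and pos: "\<And>a b. a \<noteq> b \<Longrightarrow> 0 < r a a b b"
  shows "0 < (\<Sum>s1 | s1 permutes {..<k}. \<Sum>s2 | s2 permutes {..<k}.
     \<Sum>s3 | s3 permutes {..<k}. \<Sum>s4 | s4 permutes {..<k}.
      of_int (sign s1 * sign s2 * sign s3 * sign s4) * (\<Prod>i<k. r (s1 i) (s2 i) (s3 i) (s4 i)))"
proof -
  let ?P = "{s. s permutes {..<k}}"
  let ?f = "\<lambda>s1 s2 s3 s4. of_int (sign s1 * sign s2 * sign s3 * sign s4) *
    (\<Prod>i<k. r (s1 i) (s2 i) (s3 i) (s4 i)) :: real"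
  have fin: "finite ?P"
    by (simp add: finite_permutations)
  have ge: "0 \<le> ?f s1 s2 s3 s4" if "s1 \<in> ?P" "s2 \<in> ?P" "s3 \<in> ?P" "s4 \<in> ?P" for s1 s2 s3 s4
  proof (cases "\<forall>i\<in>{..<k}. r (s1 i) (s2 i) (s3 i) (s4 i) \<noteq> 0")
    case True
    then have "sign s1 * sign s2 * sign s3 * sign s4 = 1"
      using that by (intro sign_paired_permutes[of "{..<k}"] paired) auto
    then show ?thesis by (simp add: prod_nonneg nonneg del: of_int_mult)
  next
    case False
    then have "(\<Prod>i<k. r (s1 i) (s2 i) (s3 i) (s4 i)) = 0"
      by (intro prod_zero) auto
    then show ?thesis by (simp only: mult_zero_right order_refl)
  qed
  obtain c where c: "c permutes {..<k}" "\<And>i. i < k \<Longrightarrow> c i \<noteq> i"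
    using fixpoint_free_permutation[OF k] by blast
  have cP: "c \<in> ?P" and idP: "id \<in> ?P"
    using c(1) by (auto simp: permutes_id)
  \<comment> \<open>The sign of \<open>c\<close> occurs twice, and the entries are
    \<open>r i i (c i) (c i)\<close>, positive because \<open>c\<close> moves every
    \<open>i\<close>.\<close>
  have "0 < ?f id id c c"
    using c(2) by (auto intro!: prod_pos pos simp: sign_id) (metis)
  then show ?thesis
    using cP idP
    by (intro sum_pos2[OF fin idP] sum_pos2[OF fin cP] sum_nonneg ge) auto
qed


section \<open>Orthonormal families and multilinear forms\<close>

lemma bilinear_form_zero_left: "bilinear_form b \<Longrightarrow> b 0 y = 0"
  by (subst bilinear_form_expand_left) auto

lemma bilinear_form_add_left: "bilinear_form b \<Longrightarrow> b (x + x') y = b x y + b x' y"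
  unfolding bilinear_form_def using module_hom.add[OF Vector_Spaces.linear.axioms(3)] by blast

lemma bilinear_form_add_right: "bilinear_form b \<Longrightarrow> b x (y + y') = b x y + b x y'"
  unfolding bilinear_form_def using module_hom.add[OF Vector_Spaces.linear.axioms(3)] by blast

lemma bilinear_form_scale_left: "bilinear_form b \<Longrightarrow> b (c *s x) y = c * b x y"
  unfolding bilinear_form_def using module_hom.scale[OF Vector_Spaces.linear.axioms(3)] by blast

lemma bilinear_form_scale_right: "bilinear_form b \<Longrightarrow> b x (c *s y) = c * b x y"
  unfolding bilinear_form_def using module_hom.scale[OF Vector_Spaces.linear.axioms(3)] by blast

lemmas bilinear_form_linear_simps =
  bilinear_form_add_left bilinear_form_add_right bilinear_form_scale_left bilinear_form_scale_right

lemma bilinear_form_sum_left: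
  "bilinear_form b \<Longrightarrow> b (\<Sum>i\<in>A. f i) y = (\<Sum>i\<in>A. b (f i) y)"
  by (induction A rule: infinite_finite_induct)
     (auto simp: bilinear_form_zero_left bilinear_form_add_left)

text \<open>Gram-Schmidt without positivity: the extension step needs a non-isotropic vector in the
  orthogonal complement \<open>W\<close> of the family. If there were none, polarisation would make
  the form vanish on \<open>W\<close>, nondegeneracy would force \<open>W = 0\<close>, and
  \<open>k\<close> vectors would span a space of larger dimension.\<close>

lemma exists_orthonormal:
  fixes ip :: "complex^'n \<Rightarrow> complex^'n \<Rightarrow> complex"
  assumes ip: "nondegenerate_symmetric_form ip" and "k \<le> CARD('n)"
  shows "\<exists>e :: nat \<Rightarrow> complex^'n. \<forall>i<k. \<forall>j<k. ip (e i) (e j) = (if i = j then 1 else 0)"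
  using assms(2)
proof (induction k)
  case (Suc k)
  have b: "bilinear_form ip" and sym: "ip x y = ip y x"
    and nondeg: "(\<And>y. ip x y = 0) \<Longrightarrow> x = 0" for x y
    using ip by (auto simp: nondegenerate_symmetric_form_def)
  note lin = bilinear_form_linear_simps[OF b]
  obtain e :: "nat \<Rightarrow> complex^'n"
    where e: "\<And>i j. i < k \<Longrightarrow> j < k \<Longrightarrow> ip (e i) (e j) = (if i = j then 1 else 0)"
    using Suc by auto
  define W where "W = {w. \<forall>i<k. ip w (e i) = 0}"
  have "\<exists>w\<in>W. ip w w \<noteq> 0"
  proof (rule ccontr)
    assume "\<not> ?thesis"
    then have iso: "ip w w = 0" if "w \<in> W" for w using that by blast
    have pol: "ip w w' = 0" if "w \<in> W" "w' \<in> W" for w w'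
    proof -
      have "w + w' \<in> W" using that by (simp add: W_def lin)
      from iso[OF this] iso[OF that(1)] iso[OF that(2)] show ?thesis
        by (simp add: lin sym[of w' w])
    qed
    have proj: "x - (\<Sum>i<k. ip x (e i) *s e i) \<in> W" for x
    proof -
      have "ip (x - (\<Sum>i<k. ip x (e i) *s e i)) (e j) = 0" if "j < k" for j
      proof -
        have "ip x (e j) = ip (x - (\<Sum>i<k. ip x (e i) *s e i) + (\<Sum>i<k. ip x (e i) *s e i)) (e j)"
          by simp
        also have "\<dots> = ip (x - (\<Sum>i<k. ip x (e i) *s e i)) (e j) + (\<Sum>i<k. ip x (e i) * ip (e i) (e j))"
          by (simp only: lin bilinear_form_sum_left[OF b])
        also have "(\<Sum>i<k. ip x (e i) * ip (e i) (e j)) = (\<Sum>i<k. if i = j then ip x (e i) else 0)"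
          by (intro sum.cong) (auto simp: e that)
        finally show ?thesis using that by simp
      qed
      then show ?thesis by (simp add: W_def)
    qed
    \<comment> \<open>A vector of \<open>W\<close> is orthogonal to the family and, by
      \<open>pol\<close>, to \<open>W\<close>; by \<open>proj\<close> the two together span
      everything.\<close>
    have W0: "w = 0" if "w \<in> W" for w
    proof (rule nondeg)
      fix x
      let ?p = "\<Sum>i<k. ip x (e i) *s e i"
      have "ip w x = ip (x - ?p + ?p) w" by (simp add: sym)
      also have "\<dots> = ip (x - ?p) w + (\<Sum>i<k. ip x (e i) * ip (e i) w)"
        by (simp only: lin bilinear_form_sum_left[OF b])
      also have "\<dots> = 0"
        using that pol[OF proj[of x] that] by (simp add: W_def sym[of _ w])
      finally show "ip w x = 0" .
    qed
    have "x \<in> vec.span (e ` {..<k})" for x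
    proof -
      have "x = (\<Sum>i<k. ip x (e i) *s e i)" using W0[OF proj[of x]] by simp
      also have "\<dots> \<in> vec.span (e ` {..<k})"
        by (intro vec.span_sum vec.span_scale vec.span_base) auto
      finally show ?thesis .
    qed
    then have "vec.dim (UNIV :: (complex^'n) set) \<le> card (e ` {..<k})"
      by (intro vec.dim_le_card) auto
    also have "\<dots> \<le> k" using card_image_le[of "{..<k}" e] by simp
    finally show False using Suc.prems by (simp add: card_cart_basis vec.dimension_def)
  qed
  then obtain w where w: "w \<in> W" "ip w w \<noteq> 0" by blast
  \<comment> \<open>Complex square roots allow this normalisation for every nonzero value of
    \<open>ip w w\<close>.\<close>
  define u where "u = (1 / csqrt (ip w w)) *s w"
  have "ip u u = 1"
    using w(2) power2_csqrt[of "ip w w"] by (simp add: u_def lin power2_eq_square)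
  moreover have "ip u (e i) = 0" "ip (e i) u = 0" if "i < k" for i
    using w(1) that by (auto simp: u_def lin W_def sym[of "e i"])
  ultimately have "\<forall>i<Suc k. \<forall>j<Suc k. ip ((e(k := u)) i) ((e(k := u)) j) = (if i = j then 1 else 0)"
    by (auto simp: e less_Suc_eq)
  then show ?case by blast
qed simp

section \<open>Multilinearity in coordinates\<close>

lemma linear_coords_sum:
  assumes "\<And>i. i \<in> A \<Longrightarrow> linear_coords (f i)"
  shows "linear_coords (\<lambda>x. \<Sum>i\<in>A. f i x)"
  unfolding linear_coords_def
proof
  fix x
  have "(\<Sum>i\<in>A. f i x) = (\<Sum>i\<in>A. \<Sum>a\<in>UNIV. x $ a * f i (axis a 1))"
    using assms unfolding linear_coords_def by (intro sum.cong) blast+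
  also have "\<dots> = (\<Sum>a\<in>UNIV. \<Sum>i\<in>A. x $ a * f i (axis a 1))"
    by (rule sum.swap)
  finally show "(\<Sum>i\<in>A. f i x) = (\<Sum>a\<in>UNIV. x $ a * (\<Sum>i\<in>A. f i (axis a 1)))"
    by (simp only: sum_distrib_left)
qed

lemma linear_coords_coordinate: "linear_coords (\<lambda>x. x $ p)"
  by (simp add: linear_coords_def axis_def if_distrib cong: if_cong)

lemma linear_coords_matrix:
  assumes f: "linear_coords f"
  shows "linear_coords (\<lambda>x. f (g *v x))"
proof -
  have "(\<lambda>x. f (g *v x)) = (\<lambda>x. \<Sum>a\<in>UNIV. \<Sum>b\<in>UNIV. g $ a $ b * f (axis a 1) * x $ b)"
  proof
    fix x
    have "f (g *v x) = (\<Sum>a\<in>UNIV. (g *v x) $ a * f (axis a 1))"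
      using f unfolding linear_coords_def by blast
    also have "\<dots> = (\<Sum>a\<in>UNIV. \<Sum>b\<in>UNIV. g $ a $ b * f (axis a 1) * x $ b)"
      by (simp add: matrix_vector_mult_def sum_distrib_left sum_distrib_right mult_ac)
    finally show "f (g *v x) = (\<Sum>a\<in>UNIV. \<Sum>b\<in>UNIV. g $ a $ b * f (axis a 1) * x $ b)" .
  qed
  then show ?thesis
    by (simp only:) (intro linear_coords_sum linear_coords_simps(1) linear_coords_coordinate)
qed

lemma sum_column:
  assumes "linear_coords f"
  shows "(\<Sum>a\<in>UNIV. g $ a $ b * f (axis a 1)) = f (g *v axis b 1)"
proof -
  have "f (g *v axis b 1) = (\<Sum>a\<in>UNIV. (g *v axis b 1) $ a * f (axis a 1))"
    using assms unfolding linear_coords_def by blast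
  moreover have "(g *v axis b 1) $ a = g $ a $ b" for a
    by (simp add: matrix_vector_mult_def axis_def if_distrib cong: if_cong)
  ultimately show ?thesis by simp
qed

text \<open>Linearity is expressed through basis expansions because \<open>power_form\<close>
  evaluates its form on basis vectors only; the closure rules for \<open>linear_coords\<close> then
  apply slot by slot.\<close>

definition multilinear4 ::
    "(complex^'a \<Rightarrow> complex^'a \<Rightarrow> complex^'a \<Rightarrow> complex^'a \<Rightarrow> complex) \<Rightarrow> bool" where
  "multilinear4 F \<longleftrightarrow> (\<forall>x y z.
     linear_coords (\<lambda>u. F u x y z) \<and> linear_coords (\<lambda>u. F x u y z) \<and>
     linear_coords (\<lambda>u. F x y u z) \<and> linear_coords (\<lambda>u. F x y z u))"

lemma multilinear4_linear_coords:
  assumes "multilinear4 F"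
  shows "linear_coords (\<lambda>u. F u x y z)" "linear_coords (\<lambda>u. F x u y z)"
    "linear_coords (\<lambda>u. F x y u z)" "linear_coords (\<lambda>u. F x y z u)"
  using assms by (auto simp: multilinear4_def)

lemma multilinear4_expand:
  assumes "multilinear4 F"
  shows "F x1 x2 x3 x4 = (\<Sum>a\<in>UNIV. \<Sum>b\<in>UNIV. \<Sum>c\<in>UNIV. \<Sum>d\<in>UNIV.
    x1 $ a * x2 $ b * x3 $ c * x4 $ d * F (axis a 1) (axis b 1) (axis c 1) (axis d 1))"
proof -
  note l = multilinear4_linear_coords[OF assms, unfolded linear_coords_def, rule_format]
  have e1: "F x1 x2 x3 x4 = (\<Sum>a\<in>UNIV. x1 $ a * F (axis a 1) x2 x3 x4)" by (rule l(1))
  have e2: "F (axis a 1) x2 x3 x4 = (\<Sum>b\<in>UNIV. x2 $ b * F (axis a 1) (axis b 1) x3 x4)" for a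
    by (rule l(2))
  have e3: "F (axis a 1) (axis b 1) x3 x4 =
      (\<Sum>c\<in>UNIV. x3 $ c * F (axis a 1) (axis b 1) (axis c 1) x4)" for a b
    by (rule l(3))
  have e4: "F (axis a 1) (axis b 1) (axis c 1) x4 =
      (\<Sum>d\<in>UNIV. x4 $ d * F (axis a 1) (axis b 1) (axis c 1) (axis d 1))" for a b c
    by (rule l(4))
  show ?thesis by (simp only: e1 e2 e3 e4 sum_distrib_left mult.assoc)
qed

lemma multilinear4_matrix:
  assumes "multilinear4 F"
  shows "multilinear4 (\<lambda>x y z w. F (g *v x) (g *v y) (g *v z) (g *v w))"
  using linear_coords_matrix[OF multilinear4_linear_coords(1)[OF assms]]
    linear_coords_matrix[OF multilinear4_linear_coords(2)[OF assms]]
    linear_coords_matrix[OF multilinear4_linear_coords(3)[OF assms]]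
    linear_coords_matrix[OF multilinear4_linear_coords(4)[OF assms]]
  unfolding multilinear4_def by blast

lemma multilinear4_eqI:
  assumes "multilinear4 F" "multilinear4 G"
    and "\<And>a b c d. F (axis a 1) (axis b 1) (axis c 1) (axis d 1) =
      G (axis a 1) (axis b 1) (axis c 1) (axis d 1)"
  shows "F x1 x2 x3 x4 = G x1 x2 x3 x4"
  unfolding multilinear4_expand[OF assms(1), of x1 x2 x3 x4] multilinear4_expand[OF assms(2), of x1 x2 x3 x4]
  by (simp only: assms(3))

lemma multilinear4_q_unsym: "multilinear4 (q_unsym eps ip)"
  unfolding multilinear4_def q_unsym_def
  by (intro allI conjI linear_coords_sum linear_coords_simps linear_coords_coordinate)

text \<open>For each permutation exactly one argument position of \<open>F\<close> receives the
  varied slot, so every summand is linear in it.\<close>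

lemma multilinear4_symmetrise4:
  assumes F: "multilinear4 F"
  shows "multilinear4 (symmetrise4 F)"
proof -
  \<comment> \<open>Updating entry \<open>j\<close> of a list treats all four slots at once; only
    position \<open>inv \<pi> j\<close> sees the new entry.\<close>
  have slot: "linear_coords (\<lambda>u. F (xs[j := u] ! \<pi> 0) (xs[j := u] ! \<pi> 1) (xs[j := u] ! \<pi> 2) (xs[j := u] ! \<pi> 3))"
    if \<pi>: "\<pi> permutes {..<4}" and len: "length xs = 4" and j: "j < 4" for xs \<pi> j
  proof -
    have ij: "\<pi> (inv \<pi> j) = j" and "inv \<pi> j < 4"
      using permutes_inverses[OF \<pi>] permutes_in_image[OF permutes_inv[OF \<pi>], of j] j by auto
    have hit: "xs[j := u] ! \<pi> (inv \<pi> j) = u" for u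
      using ij j len by simp
    have miss: "xs[j := u] ! \<pi> m = xs ! \<pi> m" if "m \<noteq> inv \<pi> j" for m u
      using that permutes_inverses[OF \<pi>] by (metis nth_list_update_neq)
    from \<open>inv \<pi> j < 4\<close> consider "inv \<pi> j = 0" | "inv \<pi> j = 1" | "inv \<pi> j = 2" | "inv \<pi> j = 3"
      by linarith
    then show ?thesis
      by cases (use hit miss multilinear4_linear_coords[OF F] in simp_all)
  qed
  have sym: "linear_coords (\<lambda>u. (\<Sum>\<pi> | \<pi> permutes {..<4::nat}.
      F (xs[j := u] ! \<pi> 0) (xs[j := u] ! \<pi> 1) (xs[j := u] ! \<pi> 2) (xs[j := u] ! \<pi> 3)) / fact 4)"
    if "length xs = 4" "j < 4" for xs j
    unfolding divide_inverse using that by (intro linear_coords_simps linear_coords_sum slot) auto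
  show ?thesis
    unfolding multilinear4_def symmetrise4_def
  proof (intro allI conjI)
    fix x y z :: "complex^'a"
    \<comment> \<open>In each of the four lists the entry 0 is a placeholder that the update
      overwrites.\<close>
    show "linear_coords (\<lambda>u. (\<Sum>\<pi> | \<pi> permutes {..<4::nat}. F ([u, x, y, z] ! \<pi> 0) ([u, x, y, z] ! \<pi> 1)
        ([u, x, y, z] ! \<pi> 2) ([u, x, y, z] ! \<pi> 3)) / fact 4)"
      using sym[of "[0, x, y, z]" 0] by (simp only: list_update_code) simp
    show "linear_coords (\<lambda>u. (\<Sum>\<pi> | \<pi> permutes {..<4::nat}. F ([x, u, y, z] ! \<pi> 0) ([x, u, y, z] ! \<pi> 1)
        ([x, u, y, z] ! \<pi> 2) ([x, u, y, z] ! \<pi> 3)) / fact 4)"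
      using sym[of "[x, 0, y, z]" "Suc 0"] by (simp only: list_update_code) simp
    show "linear_coords (\<lambda>u. (\<Sum>\<pi> | \<pi> permutes {..<4::nat}. F ([x, y, u, z] ! \<pi> 0) ([x, y, u, z] ! \<pi> 1)
        ([x, y, u, z] ! \<pi> 2) ([x, y, u, z] ! \<pi> 3)) / fact 4)"
      using sym[of "[x, y, 0, z]" "Suc (Suc 0)"] by (simp only: list_update_code) simp
    show "linear_coords (\<lambda>u. (\<Sum>\<pi> | \<pi> permutes {..<4::nat}. F ([x, y, z, u] ! \<pi> 0) ([x, y, z, u] ! \<pi> 1)
        ([x, y, z, u] ! \<pi> 2) ([x, y, z, u] ! \<pi> 3)) / fact 4)"
      using sym[of "[x, y, z, 0]" "Suc (Suc (Suc 0))"] by (simp only: list_update_code) simp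
  qed
qed

lemma multilinear4_q_form: "multilinear4 (q_form eps ip)"
  unfolding q_form_def by (intro multilinear4_symmetrise4 multilinear4_q_unsym)

text \<open>Since \<open>h\<close> is arbitrary, this serves both for a matrix acting on vectors and
  for the passage from indices to a family of vectors.\<close>

lemma symmetrise4_map:
  "symmetrise4 F (h x1) (h x2) (h x3) (h x4) = symmetrise4 (\<lambda>x y z w. F (h x) (h y) (h z) (h w)) x1 x2 x3 x4"
proof -
  have "[h x1, h x2, h x3, h x4] ! i = h ([x1, x2, x3, x4] ! i)" if "i < 4" for i
    using nth_map[of i "[x1, x2, x3, x4]" h] that by simp
  moreover have "\<pi> i < 4" if "\<pi> permutes {..<4::nat}" "i < 4" for \<pi> i
    using that permutes_in_image[of \<pi> "{..<4}" i] by simp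
  ultimately show ?thesis
    by (auto simp: symmetrise4_def intro!: sum.cong)
qed


section \<open>Linear maps acting on tensors\<close>

text \<open>A product of one-slot functions is a decomposable functional on tensors; its pullback
  along \<open>g\<close> is again decomposable, with \<open>g\<close> transposed in each
  slot.\<close>

lemma sum_tensor_map:
  "(\<Sum>l | length l = k. tensor_map g T l * (\<Prod>i<k. f i (l ! i))) =
   (\<Sum>m | length m = k. T m * (\<Prod>i<k. \<Sum>a\<in>UNIV. g $ a $ (m ! i) * f i a))"
proof -
  have "(\<Sum>l | length l = k. tensor_map g T l * (\<Prod>i<k. f i (l ! i))) =
      (\<Sum>l | length l = k. \<Sum>m | length m = k. T m * (\<Prod>i<k. g $ (l ! i) $ (m ! i) * f i (l ! i)))"
    by (simp add: tensor_map_def sum_distrib_left sum_distrib_right prod.distrib mult_ac)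
  also have "\<dots> = (\<Sum>m | length m = k. T m * (\<Sum>l | length l = k. \<Prod>i<k. g $ (l ! i) $ (m ! i) * f i (l ! i)))"
    by (subst sum.swap) (simp add: sum_distrib_left)
  finally show ?thesis
    by (simp only: sum_lists_prod[of "\<lambda>i a. g $ a $ (m ! i) * f i a" k for m])
qed

lemma tensor_map_compose: "tensor_map g (tensor_map h T) = tensor_map (g ** h) T"
proof
  fix l :: "'a list"
  have "tensor_map g (tensor_map h T) l =
      (\<Sum>m | length m = length l. tensor_map h T m * (\<Prod>i<length l. g $ (l ! i) $ (m ! i)))"
    by (simp add: tensor_map_def[of g] mult.commute)
  also have "\<dots> = (\<Sum>m | length m = length l. T m * (\<Prod>i<length l. \<Sum>a\<in>UNIV. h $ a $ (m ! i) * g $ (l ! i) $ a))"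
    by (rule sum_tensor_map)
  finally show "tensor_map g (tensor_map h T) l = tensor_map (g ** h) T l"
    by (simp add: tensor_map_def[of _ T] matrix_matrix_mult_def mult.commute)
qed

lemma finite_lists_length: "finite {l :: 'b::finite list. length l = k}"
  using finite_lists_length_eq[of "UNIV :: 'b set" k] by simp

lemma tensor_map_id: "tensor_map (mat 1) T = T"
proof
  fix l :: "'a list"
  have "(\<Prod>i<length l. mat 1 $ (l ! i) $ (m ! i)) = (if m = l then 1 else 0 :: complex)"
    if "length m = length l" for m
  proof (cases "m = l")
    case False
    then obtain i where "i < length l" "m ! i \<noteq> l ! i"
      using \<open>length m = length l\<close> nth_equalityI by metis
    then show ?thesis
      using False by (auto simp: mat_def intro!: prod_zero bexI[of _ i])
  qed (simp add: mat_def)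
  then have "tensor_map (mat 1) T l = (\<Sum>m | length m = length l. if m = l then T m else 0)"
    unfolding tensor_map_def by (intro sum.cong) auto
  then show "tensor_map (mat 1) T l = T l"
    by (simp add: finite_lists_length)
qed

lemma tensor_map_add: "tensor_map g (S + T) = tensor_map g S + tensor_map g T"
  by (simp add: tensor_map_def fun_eq_iff distrib_left sum.distrib)

lemma tensor_map_scale: "tensor_map g (scale_tensor c T) = scale_tensor c (tensor_map g T)"
  by (simp add: tensor_map_def scale_tensor_def fun_eq_iff sum_distrib_left mult.left_commute)

lemma tensor_map_zero: "tensor_map g 0 = 0"
  by (simp add: tensor_map_def fun_eq_iff)

lemma tensor_map_wedge: "tensor_map g (wedge k v) = wedge k (\<lambda>i. g *v v i)"
proof
  fix l :: "'a list"
  show "tensor_map g (wedge k v) l = wedge k (\<lambda>i. g *v v i) l"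
  proof (cases "length l = k")
    case True
    then have "tensor_map g (wedge k v) l =
        (\<Sum>m | length m = k. wedge k v m * (\<Prod>i<k. g $ (l ! i) $ (m ! i)))"
      by (simp add: tensor_map_def mult.commute)
    then show ?thesis
      using True sum_wedge_prod[of k v "\<lambda>i a. g $ (l ! i) $ a"]
      by (simp add: wedge_def matrix_vector_mult_def mult.commute)
  qed (simp add: tensor_map_def wedge_def)
qed

lemma tensor_map_ext_power:
  assumes "T \<in> ext_power k U"
  shows "tensor_map g T \<in> ext_power k ((*v) g ` U)"
proof -
  have "tensor.subspace {T. tensor_map g T \<in> ext_power k ((*v) g ` U)}"
    unfolding ext_power_def
    by (intro tensor.subspaceI)
       (auto simp: tensor_map_zero tensor_map_add tensor_map_scale
         intro: tensor.span_zero tensor.span_add tensor.span_scale)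
  moreover have "{wedge k v | v. v ` {..<k} \<subseteq> U} \<subseteq> {T. tensor_map g T \<in> ext_power k ((*v) g ` U)}"
  proof clarify
    fix v :: "nat \<Rightarrow> complex^'a" assume "v ` {..<k} \<subseteq> U"
    then have "(\<lambda>i. g *v v i) ` {..<k} \<subseteq> (*v) g ` U"
      by auto
    then show "tensor_map g (wedge k v) \<in> ext_power k ((*v) g ` U)"
      unfolding ext_power_def tensor_map_wedge by (intro tensor.span_base) blast
  qed
  ultimately have "ext_power k U \<subseteq> {T. tensor_map g T \<in> ext_power k ((*v) g ` U)}"
    unfolding ext_power_def[of k U] by (intro tensor.span_minimal)
  then show ?thesis using assms by blast
qed

lemma ext_power_mono: "U \<subseteq> U' \<Longrightarrow> ext_power k U \<subseteq> ext_power k U'"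
  unfolding ext_power_def by (intro tensor.span_mono) blast

section \<open>Contraction and primitive tensors\<close>

lemma sum_lists_Suc:
  fixes f :: "'b::finite list \<Rightarrow> complex"
  shows "(\<Sum>l | length l = Suc k. f l) = (\<Sum>a\<in>UNIV. \<Sum>l | length l = k. f (a # l))"
proof -
  have "{l :: 'b list. length l = Suc k} = (\<lambda>x. fst x # snd x) ` (UNIV \<times> {l. length l = k})"
    by (auto simp: length_Suc_conv image_iff)
  moreover have "inj_on (\<lambda>x. fst x # snd x) (UNIV \<times> {l :: 'b list. length l = k})"
    by (auto simp: inj_on_def)
  ultimately show ?thesis
    by (simp add: sum.reindex sum.cartesian_product case_prod_beta)
qed

text \<open>The coordinate counterpart of \<open>bilinear_form\<close>; for \<open>omega\<close>,
  itself a coordinate sum, it follows from the closure rules alone.\<close>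

definition bilinear2 :: "(complex^'a \<Rightarrow> complex^'a \<Rightarrow> complex) \<Rightarrow> bool" where
  "bilinear2 w \<longleftrightarrow> (\<forall>x. linear_coords (w x) \<and> linear_coords (\<lambda>u. w u x))"

lemma bilinear2_linear_coords:
  assumes "bilinear2 w"
  shows "linear_coords (\<lambda>u. w u x)" "linear_coords (\<lambda>u. w x u)"
  using assms by (auto simp: bilinear2_def)

lemma bilinear2_expand:
  assumes "bilinear2 w"
  shows "w x y = (\<Sum>a\<in>UNIV. \<Sum>b\<in>UNIV. x $ a * y $ b * w (axis a 1) (axis b 1))"
proof -
  note l = bilinear2_linear_coords[OF assms, unfolded linear_coords_def, rule_format]
  have e1: "w x y = (\<Sum>a\<in>UNIV. x $ a * w (axis a 1) y)" by (rule l(1))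
  have e2: "w (axis a 1) y = (\<Sum>b\<in>UNIV. y $ b * w (axis a 1) (axis b 1))" for a
    by (rule l(2))
  show ?thesis by (simp only: e1 e2 sum_distrib_left mult.assoc)
qed

text \<open>The two contracted slots carry two copies of \<open>g\<close>, which the invariance of
  \<open>w\<close> absorbs; the remaining slots keep theirs.\<close>

lemma contraction_tensor_map:
  assumes w: "bilinear2 w" and inv: "\<And>x y. w (g *v x) (g *v y) = w x y"
  shows "contraction w (tensor_map g T) = tensor_map g (contraction w T)"
proof
  fix l :: "'a list"
  let ?M = "{m :: 'a list. length m = length l}"
  let ?h = "\<lambda>a b c d m. w (axis a 1) (axis b 1) * g $ a $ c * g $ b $ d *
    (\<Prod>i<length l. g $ (l ! i) $ (m ! i)) * T (c # d # m)"
  have col: "(g *v axis c 1) $ a = g $ a $ c" for a c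
    by (simp add: matrix_vector_mult_def axis_def if_distrib cong: if_cong)
  \<comment> \<open>Invariance on basis vectors, written in matrix entries, is what sums away the
    two columns of \<open>g\<close>.\<close>
  have wcd: "w (axis c 1) (axis d 1) =
      (\<Sum>a\<in>UNIV. \<Sum>b\<in>UNIV. g $ a $ c * g $ b $ d * w (axis a 1) (axis b 1))" for c d
    by (subst inv[symmetric], subst bilinear2_expand[OF w]) (simp only: col)
  have swap: "(\<Sum>x\<in>X. \<Sum>c\<in>UNIV. \<Sum>d\<in>UNIV. \<Sum>m\<in>?M. f x c d m) =
      (\<Sum>c\<in>UNIV. \<Sum>d\<in>UNIV. \<Sum>m\<in>?M. \<Sum>x\<in>X. f x c d m)"
    for X :: "'a set" and f :: "'a \<Rightarrow> 'a \<Rightarrow> 'a \<Rightarrow> 'a list \<Rightarrow> complex"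
    by (simp only: sum.swap[where A = X])
  have "contraction w (tensor_map g T) l = (\<Sum>a\<in>UNIV. \<Sum>b\<in>UNIV. \<Sum>c\<in>UNIV. \<Sum>d\<in>UNIV. \<Sum>m\<in>?M. ?h a b c d m)"
    by (simp add: contraction_def tensor_map_def sum_lists_Suc prod.lessThan_Suc_shift
        sum_distrib_left mult_ac del: prod.lessThan_Suc)
  also have "\<dots> = (\<Sum>c\<in>UNIV. \<Sum>d\<in>UNIV. \<Sum>m\<in>?M. \<Sum>a\<in>UNIV. \<Sum>b\<in>UNIV. ?h a b c d m)"
    by (simp only: swap)
  also have "\<dots> = (\<Sum>c\<in>UNIV. \<Sum>d\<in>UNIV. \<Sum>m\<in>?M.
      (\<Prod>i<length l. g $ (l ! i) $ (m ! i)) * (w (axis c 1) (axis d 1) * T (c # d # m)))"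
    by (intro sum.cong refl, subst wcd) (simp add: sum_distrib_left sum_distrib_right mult_ac)
  also have "\<dots> = (\<Sum>m\<in>?M. \<Sum>c\<in>UNIV. \<Sum>d\<in>UNIV.
      (\<Prod>i<length l. g $ (l ! i) $ (m ! i)) * (w (axis c 1) (axis d 1) * T (c # d # m)))"
    by (simp only: sum.swap[where B = ?M])
  also have "\<dots> = tensor_map g (contraction w T) l"
    by (simp add: tensor_map_def contraction_def sum_distrib_left)
  finally show "contraction w (tensor_map g T) l = tensor_map g (contraction w T) l" .
qed

text \<open>Each term of the alternating sum contracts its first two factors to a value of
  \<open>w\<close> on two of the vectors. On words of any other length the wedge itself contributes
  zero.\<close>

lemma contraction_wedge_isotropic:
  assumes w: "bilinear2 w" and iso: "\<And>i j. i < k \<Longrightarrow> j < k \<Longrightarrow> w (v i) (v j) = 0"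
  shows "contraction w (wedge k v) = 0"
proof
  fix l :: "'a list"
  show "contraction w (wedge k v) l = 0 l"
  proof (cases "k = Suc (Suc (length l))")
    case True
    let ?P = "{s. s permutes {..<k}}"
    let ?c = "\<lambda>s. of_int (sign s) * (\<Prod>i<length l. v (s (Suc (Suc i))) $ (l ! i)) :: complex"
    have "contraction w (wedge k v) l =
        (\<Sum>a\<in>UNIV. \<Sum>b\<in>UNIV. \<Sum>s\<in>?P. ?c s * (v (s 0) $ a * v (s (Suc 0)) $ b * w (axis a 1) (axis b 1)))"
      using True
      by (simp add: contraction_def wedge_def prod.lessThan_Suc_shift sum_distrib_left mult_ac
          del: prod.lessThan_Suc)
    also have "\<dots> = (\<Sum>s\<in>?P. ?c s * w (v (s 0)) (v (s (Suc 0))))"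
      by (subst bilinear2_expand[OF w]) (simp only: sum_distrib_left sum.swap[where B = ?P])
    also have "\<dots> = 0"
    proof (intro sum.neutral ballI)
      fix s assume "s \<in> ?P"
      then have "s 0 < k" "s (Suc 0) < k"
        using permutes_in_image[of s "{..<k}"] True by (metis lessThan_iff mem_Collect_eq zero_less_Suc, metis lessThan_iff mem_Collect_eq zero_less_Suc Suc_mono)
      then show "?c s * w (v (s 0)) (v (s (Suc 0))) = 0"
        by (simp add: iso)
    qed
    finally show ?thesis by simp
  qed (auto simp: contraction_def wedge_def)
qed

lemma contraction_add: "contraction w (S + T) = contraction w S + contraction w T"
  by (simp add: contraction_def fun_eq_iff distrib_left sum.distrib)

lemma contraction_scale: "contraction w (scale_tensor c T) = scale_tensor c (contraction w T)"
  by (simp add: contraction_def scale_tensor_def fun_eq_iff sum_distrib_left mult_ac)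

lemma contraction_zero: "contraction w 0 = 0"
  by (simp add: contraction_def fun_eq_iff)

text \<open>This puts the cone over the Lagrangian Grassmannian inside the primitive tensors;
  linearity of the contraction reduces it to wedges.\<close>

lemma ext_power_isotropic_primitive:
  assumes w: "bilinear2 w" and iso: "\<And>x y. x \<in> L \<Longrightarrow> y \<in> L \<Longrightarrow> w x y = 0"
  shows "ext_power k L \<subseteq> primitive_ext_power k w"
proof -
  have "tensor.subspace {T. contraction w T = 0}"
    by (intro tensor.subspaceI) (auto simp: contraction_zero contraction_add contraction_scale)
  moreover have "{wedge k v | v. v ` {..<k} \<subseteq> L} \<subseteq> {T. contraction w T = 0}"
    using iso by (auto intro!: contraction_wedge_isotropic[OF w])
  ultimately have "ext_power k L \<subseteq> {T. contraction w T = 0}"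
    unfolding ext_power_def by (intro tensor.span_minimal)
  then show ?thesis
    using ext_power_mono[of L UNIV k] by (auto simp: primitive_ext_power_def)
qed

lemma tensor_map_primitive_ext_power:
  assumes "bilinear2 w" "\<And>x y. w (g *v x) (g *v y) = w x y" "T \<in> primitive_ext_power k w"
  shows "tensor_map g T \<in> primitive_ext_power k w"
proof -
  have "tensor_map g T \<in> ext_power k UNIV"
    using assms(3) tensor_map_ext_power[of T k UNIV g] ext_power_mono[of "range ((*v) g)" UNIV k]
    by (auto simp: primitive_ext_power_def)
  then show ?thesis
    using assms by (simp add: primitive_ext_power_def contraction_tensor_map tensor_map_zero)
qed

text \<open>By linearity in each slot, \<open>g\<close> moves from the tensors to the basis vectors
  fed to \<open>F\<close>, where invariance removes it.\<close>

lemma power_form_tensor_map: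
  fixes F :: "complex^'b \<Rightarrow> complex^'b \<Rightarrow> complex^'b \<Rightarrow> complex^'b \<Rightarrow> complex"
  assumes F: "multilinear4 F"
    and inv: "\<And>x y z u. F (g *v x) (g *v y) (g *v z) (g *v u) = F x y z u"
  shows "power_form k F (tensor_map g T1) (tensor_map g T2) (tensor_map g T3) (tensor_map g T4) =
    power_form k F T1 T2 T3 T4"
proof -
  let ?L = "{l :: 'b list. length l = k}"
  let ?e = "\<lambda>a. axis a 1 :: complex^'b"
  let ?g = "\<lambda>a. g *v axis a 1 :: complex^'b"
  have col: "(\<Sum>a\<in>UNIV. g $ a $ b * f (?e a)) = f (?g b)" if "linear_coords f" for f b
    using that by (rule sum_column)
  note lin = multilinear4_linear_coords[OF F]
  \<comment> \<open>A sum over words that has been rewritten is moved outward, so that the next one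
    becomes innermost. The four sums end up in reversed order, which \<open>sum_reverse4\<close>
    undoes.\<close>
  have p: "(\<Sum>l\<in>?L. tensor_map g T l * (\<Sum>m\<in>?L. c m * G m l)) =
      (\<Sum>m\<in>?L. c m * (\<Sum>l\<in>?L. tensor_map g T l * G m l))"
    for T c :: "'b list \<Rightarrow> complex" and G
    by (simp add: sum_distrib_left mult.left_commute) (rule sum.swap)
  have P4: "(\<Sum>l\<in>?L. tensor_map g T l * (\<Prod>i<k. F (?e (x i)) (?e (y i)) (?e (z i)) (?e (l ! i)))) =
      (\<Sum>m\<in>?L. T m * (\<Prod>i<k. F (?e (x i)) (?e (y i)) (?e (z i)) (?g (m ! i))))" for T x y z
    by (subst sum_tensor_map[of g T "\<lambda>i a. F (?e (x i)) (?e (y i)) (?e (z i)) (?e a)" k])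
       (simp only: col[OF lin(4)])
  have P3: "(\<Sum>l\<in>?L. tensor_map g T l * (\<Prod>i<k. F (?e (x i)) (?e (y i)) (?e (l ! i)) (z i))) =
      (\<Sum>m\<in>?L. T m * (\<Prod>i<k. F (?e (x i)) (?e (y i)) (?g (m ! i)) (z i)))" for T x y z
    by (subst sum_tensor_map[of g T "\<lambda>i a. F (?e (x i)) (?e (y i)) (?e a) (z i)" k])
       (simp only: col[OF lin(3)])
  have P2: "(\<Sum>l\<in>?L. tensor_map g T l * (\<Prod>i<k. F (?e (x i)) (?e (l ! i)) (y i) (z i))) =
      (\<Sum>m\<in>?L. T m * (\<Prod>i<k. F (?e (x i)) (?g (m ! i)) (y i) (z i)))" for T x y z
    by (subst sum_tensor_map[of g T "\<lambda>i a. F (?e (x i)) (?e a) (y i) (z i)" k])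
       (simp only: col[OF lin(2)])
  have P1: "(\<Sum>l\<in>?L. tensor_map g T l * (\<Prod>i<k. F (?e (l ! i)) (x i) (y i) (z i))) =
      (\<Sum>m\<in>?L. T m * (\<Prod>i<k. F (?g (m ! i)) (x i) (y i) (z i)))" for T x y z
    by (subst sum_tensor_map[of g T "\<lambda>i a. F (?e a) (x i) (y i) (z i)" k])
       (simp only: col[OF lin(1)])
  have nested: "power_form k F T1 T2 T3 T4 =
      (\<Sum>l1\<in>?L. T1 l1 * (\<Sum>l2\<in>?L. T2 l2 * (\<Sum>l3\<in>?L. T3 l3 * (\<Sum>l4\<in>?L. T4 l4 *
         (\<Prod>i<k. F (?e (l1 ! i)) (?e (l2 ! i)) (?e (l3 ! i)) (?e (l4 ! i)))))))" for T1 T2 T3 T4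
    by (simp add: power_form_def sum_distrib_left mult_ac)
  have "power_form k F (tensor_map g T1) (tensor_map g T2) (tensor_map g T3) (tensor_map g T4) =
      (\<Sum>m4\<in>?L. T4 m4 * (\<Sum>m3\<in>?L. T3 m3 * (\<Sum>m2\<in>?L. T2 m2 * (\<Sum>m1\<in>?L. T1 m1 *
         (\<Prod>i<k. F (?g (m1 ! i)) (?g (m2 ! i)) (?g (m3 ! i)) (?g (m4 ! i)))))))"
    by (simp only: nested P4 P3 P2 P1 p)
  also have "\<dots> = (\<Sum>m4\<in>?L. \<Sum>m3\<in>?L. \<Sum>m2\<in>?L. \<Sum>m1\<in>?L.
      (\<Prod>i<k. F (?e (m1 ! i)) (?e (m2 ! i)) (?e (m3 ! i)) (?e (m4 ! i))) * (T1 m1 * T2 m2 * T3 m3 * T4 m4))"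
    by (simp only: inv sum_distrib_left) (simp only: mult_ac)
  finally show ?thesis
    unfolding power_form_def by (rule trans[OF _ sum_reverse4])
qed


section \<open>Invariance under the structure group\<close>

lemma formsI:
  assumes "finite A" "\<And>j i. j \<in> A \<Longrightarrow> i < d \<Longrightarrow> \<phi> j i \<in> dual_space W"
  shows "(\<lambda>x\<in>W. \<Sum>j\<in>A. c j * (\<Prod>i<d. \<phi> j i x)) \<in> forms d W"
proof -
  obtain h where h: "bij_betw h {0..<card A} A"
    using ex_bij_betw_nat_finite[OF assms(1)] by blast
  have "(\<Sum>j\<in>A. c j * (\<Prod>i<d. \<phi> j i x)) = (\<Sum>j<card A. c (h j) * (\<Prod>i<d. \<phi> (h j) i x))" for x
    using sum.reindex_bij_betw[OF h, of "\<lambda>j. c j * (\<Prod>i<d. \<phi> j i x)"] by (simp add: atLeast0LessThan)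
  moreover have "\<forall>j<card A. \<forall>i<d. \<phi> (h j) i \<in> dual_space W"
    using assms(2) bij_betw_apply[OF h] by simp
  ultimately show ?thesis
    unfolding forms_def
    by (intro CollectI conjI restrict_extensional exI[of _ "card A"] exI[of _ "\<lambda>j. c (h j)"]
        exI[of _ "\<lambda>j. \<phi> (h j)"]) simp_all
qed

lemma forms_zero: "(\<lambda>x\<in>W. 0) \<in> forms d W"
  using formsI[of "{}" d undefined W] by simp

lemma dual_space_coordinate: "(\<lambda>T. T l) \<in> dual_space W"
  by (simp add: dual_space_def scale_tensor_def)

text \<open>Summands are indexed by quadruples of words, and each is a constant times four
  coordinate functionals.\<close>

lemma power_form_in_forms:
  "(\<lambda>x\<in>W. power_form k F x x x x) \<in> forms 4 W"
proof -
  let ?L = "{l :: 'b list. length l = k}"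
  let ?A = "?L \<times> ?L \<times> ?L \<times> ?L"
  let ?n = "\<lambda>(l1, l2, l3, l4). (!) [l1, l2, l3, l4]"
  let ?c = "\<lambda>(l1, l2, l3, l4). \<Prod>i<k. F (axis (l1 ! i) 1) (axis (l2 ! i) 1) (axis (l3 ! i) 1) (axis (l4 ! i) 1)"
  have "power_form k F x x x x = (\<Sum>j\<in>?A. ?c j * (\<Prod>i<4. x (?n j i)))" for x
    by (simp add: power_form_def sum.cartesian_product case_prod_beta eval_nat_numeral mult_ac)
  then show ?thesis
    using formsI[of ?A 4 "\<lambda>j i T. T (?n j i)" W ?c]
    by (simp add: finite_lists_length dual_space_coordinate)
qed

lemma form_action_in_forms:
  assumes f: "f \<in> forms d W" and W: "\<And>x. x \<in> W \<Longrightarrow> tensor_map (matrix_inv g) x \<in> W"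
  shows "form_action W g f \<in> forms d W"
proof -
  let ?h = "tensor_map (matrix_inv g)"
  obtain N :: nat and c \<phi> where \<phi>: "\<forall>j<N. \<forall>i<d. \<phi> j i \<in> dual_space W"
    and fx: "\<forall>x\<in>W. f x = (\<Sum>j<N. c j * (\<Prod>i<d. \<phi> j i x))"
    using f unfolding forms_def by blast
  have "form_action W g f = (\<lambda>x\<in>W. \<Sum>j<N. c j * (\<Prod>i<d. \<phi> j i (?h x)))"
    by (auto simp: form_action_def fx W intro!: restrict_ext)
  also have "\<dots> \<in> forms d W"
  proof (rule formsI[of "{..<N}" d "\<lambda>j i x. \<phi> j i (?h x)"])
    fix j i assume "j \<in> {..<N}" "i < d"
    then have "\<phi> j i \<in> dual_space W" using \<phi> by simp
    then show "(\<lambda>x. \<phi> j i (?h x)) \<in> dual_space W"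
      by (simp add: dual_space_def W tensor_map_add tensor_map_scale)
  qed simp
  finally show ?thesis .
qed

lemma matrix_inv_unique:
  assumes "A ** B = mat 1" "B ** A = mat 1"
  shows "matrix_inv A = B"
proof -
  have "A ** matrix_inv A = mat 1 \<and> matrix_inv A ** A = mat 1"
    unfolding matrix_inv_def by (rule someI[of _ B]) (use assms in blast)
  then show ?thesis
    by (metis assms(1) matrix_mul_assoc matrix_mul_lid matrix_mul_rid)
qed

text \<open>If \<open>u\<close> is congruent to the invariant form \<open>f\<close>, then
  \<open>f - g u = g (f - u)\<close>, which vanishes on \<open>X\<close> because \<open>X\<close> is
  stable under inverses of group elements. That the image is the whole class uses the inverse of
  \<open>g\<close> once more.\<close>

lemma class_in_invariant_classes:
  assumes f: "f \<in> forms d W" and XW: "X \<subseteq> W"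
    and inverse: "\<And>g. g \<in> G \<Longrightarrow> \<exists>h\<in>G. g ** h = mat 1 \<and> h ** g = mat 1"
    and W: "\<And>g x. g \<in> G \<Longrightarrow> x \<in> W \<Longrightarrow> tensor_map g x \<in> W"
    and X: "\<And>g x. g \<in> G \<Longrightarrow> x \<in> X \<Longrightarrow> tensor_map g x \<in> X"
    and f_inv: "\<And>g. g \<in> G \<Longrightarrow> form_action W g f = f"
  shows "congruent_forms d W X `` {f} \<in> invariant_classes d W X G"
proof -
  let ?C = "congruent_forms d W X `` {f}"
  have closed: "form_action W g u \<in> ?C" if g: "g \<in> G" and u: "u \<in> ?C" for g u
  proof -
    obtain h where h: "h \<in> G" "matrix_inv g = h"
      using inverse[OF g] matrix_inv_unique by metis
    have u': "u \<in> forms d W" "(\<lambda>x\<in>W. f x - u x) \<in> vanishing_forms d W X"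
      using u by (auto simp: congruent_forms_def)
    have diff: "(\<lambda>x\<in>W. f x - form_action W g u x) = form_action W g (\<lambda>x\<in>W. f x - u x)"
    proof (rule trans[OF restrict_ext])
      fix x assume x: "x \<in> W"
      then have "f x = f (tensor_map h x)"
        using fun_cong[OF f_inv[OF g], of x] h by (simp add: form_action_def)
      then show "f x - form_action W g u x = f (tensor_map h x) - u (tensor_map h x)"
        using x h by (simp add: form_action_def)
    qed (auto simp: form_action_def h W intro!: restrict_ext)
    have "form_action W g u \<in> forms d W" "form_action W g (\<lambda>x\<in>W. f x - u x) \<in> forms d W"
      using u' h W by (auto intro!: form_action_in_forms simp: vanishing_forms_def)
    moreover have "form_action W g (\<lambda>x\<in>W. f x - u x) x = 0" if "x \<in> X" for x
    proof -
      have "tensor_map h x \<in> X" using X h that by blast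
      then have "(\<lambda>x\<in>W. f x - u x) (tensor_map h x) = 0"
        using u'(2) by (simp add: vanishing_forms_def)
      then show ?thesis
        using that XW h by (auto simp: form_action_def)
    qed
    ultimately have "(\<lambda>x\<in>W. f x - form_action W g u x) \<in> vanishing_forms d W X"
      unfolding diff vanishing_forms_def by blast
    with f \<open>form_action W g u \<in> forms d W\<close> show ?thesis
      by (simp add: congruent_forms_def)
  qed
  have "form_action W g ` ?C = ?C" if g: "g \<in> G" for g
  proof
    show "form_action W g ` ?C \<subseteq> ?C" using closed[OF g] by blast
    obtain h where h: "h \<in> G" "g ** h = mat 1" "h ** g = mat 1"
      using inverse[OF g] by blast
    show "?C \<subseteq> form_action W g ` ?C"
    proof
      fix u assume u: "u \<in> ?C"
      \<comment> \<open>Forms are extensional, so the equation with a restricted function also holds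
        outside \<open>W\<close>.\<close>
      then have "u \<in> extensional W" by (auto simp: congruent_forms_def forms_def)
      then have "u = form_action W g (form_action W h u)"
        using h W
        by (intro ext)
           (auto simp: form_action_def matrix_inv_unique[OF h(2,3)] matrix_inv_unique[OF h(3,2)]
              tensor_map_compose tensor_map_id extensional_def)
      then show "u \<in> form_action W g ` ?C"
        using closed[OF h(1) u] by blast
    qed
  qed
  moreover have "?C \<in> forms d W // congruent_forms d W X"
    using f by (rule quotientI)
  ultimately show ?thesis by (simp add: invariant_classes_def)
qed

section \<open>Pure tensors and invariance of the structure forms\<close>

lemma tensor_vec_axis: "tensor_vec (axis i 1) (axis j 1) = axis (i, j) 1"
  by (auto simp: tensor_vec_def vec_eq_iff axis_def)

lemma kronecker_tensor_vec: "kronecker A B *v tensor_vec x y = tensor_vec (A *v x) (B *v y)"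
  by (simp add: kronecker_def tensor_vec_def vec_eq_iff matrix_vector_mult_def sum_UNIV_prod sum_product)
     (simp only: mult_ac simp_thms)

lemma kronecker_mult: "kronecker A B ** kronecker A' B' = kronecker (A ** A') (B ** B')"
  by (simp add: kronecker_def vec_eq_iff matrix_matrix_mult_def sum_UNIV_prod sum_product)
     (simp only: mult_ac simp_thms)

lemma kronecker_id: "kronecker (mat 1) (mat 1) = mat 1"
  by (auto simp: kronecker_def vec_eq_iff mat_def prod_eq_iff)

lemma volume_form_skew:
  assumes "volume_form eps"
  shows "eps x y = - eps y x"
proof -
  have b: "bilinear_form eps" and z: "\<And>x. eps x x = 0"
    using assms by (auto simp: volume_form_def)
  have "eps (x + y) (x + y) = 0" by (rule z)
  then have "eps x y + eps y x = 0"
    by (simp add: bilinear_form_linear_simps[OF b] z[of x] z[of y] add.commute)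
  then show ?thesis by (simp add: eq_neg_iff_add_eq_0)
qed

text \<open>In dimension two an alternating form is a multiple of the coordinate determinant, and
  determinants are multiplicative.\<close>

lemma volume_form_matrix:
  assumes "volume_form eps"
  shows "eps (A *v x) (A *v y) = det A * eps x y"
proof -
  have b: "bilinear_form eps" and z: "\<And>x. eps x x = 0"
    using assms by (auto simp: volume_form_def)
  let ?e1 = "axis 1 1 :: complex^2" and ?e2 = "axis 2 1 :: complex^2"
  note skew = volume_form_skew[OF assms, of ?e2 ?e1]
  have *: "eps x y = (x $ 1 * y $ 2 - x $ 2 * y $ 1) * eps ?e1 ?e2" for x y
    by (subst bilinear_form_expand[OF b]) (simp add: UNIV_2 z skew algebra_simps)
  show ?thesis
    by (subst (1 2) *) (simp add: matrix_vector_mult_def det_2 UNIV_2 algebra_simps)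
qed

lemma bilinear2_omega: "bilinear2 (omega eps ip)"
  unfolding bilinear2_def omega_def
  by (intro allI conjI linear_coords_sum linear_coords_simps linear_coords_coordinate)

text \<open>Both sides are bilinear, so basis vectors suffice. These are pure tensors, on which the
  \<open>eps\<close> factor picks up \<open>det A = 1\<close> and the \<open>ip\<close> factor is
  preserved by \<open>B\<close>.\<close>

lemma omega_kronecker:
  assumes "volume_form eps" "bilinear_form ip" "det A = 1" "B \<in> special_orthogonal ip"
  shows "omega eps ip (kronecker A B *v x) (kronecker A B *v y) = omega eps ip x y"
proof -
  let ?g = "kronecker A B"
  have b: "bilinear_form eps" using assms by (simp add: volume_form_def)
  have "bilinear2 (\<lambda>x y. omega eps ip (?g *v x) (?g *v y))"
    using linear_coords_matrix[OF bilinear2_linear_coords(1)[OF bilinear2_omega]]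
      linear_coords_matrix[OF bilinear2_linear_coords(2)[OF bilinear2_omega]]
    unfolding bilinear2_def by blast
  moreover have "omega eps ip (?g *v axis p 1) (?g *v axis r 1) = omega eps ip (axis p 1) (axis r 1)" for p r
    using assms
    by (cases p; cases r)
       (simp add: tensor_vec_axis[symmetric] kronecker_tensor_vec omega_tensor_vec b
          volume_form_matrix special_orthogonal_def del: matrix_vector_mult_basis)
  ultimately show ?thesis
    using bilinear2_expand[of "\<lambda>x y. omega eps ip (?g *v x) (?g *v y)" x y]
      bilinear2_expand[OF bilinear2_omega, of eps ip x y] by simp
qed

text \<open>The same comparison on basis vectors is made before symmetrisation, which commutes with
  applying one matrix to all four arguments.\<close>

lemma q_form_kronecker:
  assumes "volume_form eps" "bilinear_form ip" "det A = 1" "B \<in> special_orthogonal ip"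
  shows "q_form eps ip (kronecker A B *v x1) (kronecker A B *v x2) (kronecker A B *v x3) (kronecker A B *v x4) =
    q_form eps ip x1 x2 x3 x4"
proof -
  let ?g = "kronecker A B"
  have b: "bilinear_form eps" using assms by (simp add: volume_form_def)
  have "q_unsym eps ip (?g *v axis p 1) (?g *v axis r 1) (?g *v axis s 1) (?g *v axis t 1) =
      q_unsym eps ip (axis p 1) (axis r 1) (axis s 1) (axis t 1)" for p r s t
    using assms
    by (cases p; cases r; cases s; cases t)
       (simp add: tensor_vec_axis[symmetric] kronecker_tensor_vec q_unsym_tensor_vec b
          volume_form_matrix special_orthogonal_def del: matrix_vector_mult_basis)
  then have "q_unsym eps ip (?g *v x) (?g *v y) (?g *v z) (?g *v u) = q_unsym eps ip x y z u" for x y z u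
    by (rule multilinear4_eqI[OF multilinear4_matrix[OF multilinear4_q_unsym] multilinear4_q_unsym])
  then show ?thesis
    unfolding q_form_def symmetrise4_map[of _ "(*v) ?g"] by simp
qed

lemma G0ss_inverse:
  assumes "g \<in> G0ss ip"
  shows "\<exists>h\<in>G0ss ip. g ** h = mat 1 \<and> h ** g = mat 1"
proof -
  obtain A B where g: "g = kronecker A B" and A: "det A = 1" and B: "det B = 1"
    and ip: "\<And>x y. ip (B *v x) (B *v y) = ip x y"
    using assms by (auto simp: G0ss_def special_orthogonal_def)
  have "invertible A" "invertible B" using A B by (simp_all add: invertible_det_nz)
  then obtain A' B' where A': "A ** A' = mat 1" "A' ** A = mat 1" and B': "B ** B' = mat 1" "B' ** B = mat 1"
    unfolding invertible_def by blast
  have "det A' = 1" "det B' = 1"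
    using det_mul[of A A'] det_mul[of B B'] A B A' B' by simp_all
  moreover have "ip (B' *v x) (B' *v y) = ip x y" for x y
    using ip[of "B' *v x" "B' *v y"] B' by (simp add: matrix_vector_mul_assoc)
  ultimately have "kronecker A' B' \<in> G0ss ip"
    by (auto simp: G0ss_def special_orthogonal_def)
  then show ?thesis
    unfolding g
    by (intro bexI[of _ "kronecker A' B'"] conjI) (simp_all only: kronecker_mult kronecker_id A' B')
qed

section \<open>The quartic as an invariant class in degree four\<close>

context
  fixes eps :: "complex^2 \<Rightarrow> complex^2 \<Rightarrow> complex" and ip :: "complex^'n \<Rightarrow> complex^'n \<Rightarrow> complex"
  assumes eps: "volume_form eps" and ip: "nondegenerate_symmetric_form ip"
begin

lemma G0ss_omega:
  assumes "g \<in> G0ss ip"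
  shows "omega eps ip (g *v x) (g *v y) = omega eps ip x y"
proof -
  obtain A B where "g = kronecker A B" "det A = 1" "B \<in> special_orthogonal ip"
    using assms by (auto simp: G0ss_def)
  moreover have "bilinear_form ip"
    using ip by (simp add: nondegenerate_symmetric_form_def)
  ultimately show ?thesis
    using omega_kronecker[OF eps] by blast
qed

lemma G0ss_q_form:
  assumes "g \<in> G0ss ip"
  shows "q_form eps ip (g *v x1) (g *v x2) (g *v x3) (g *v x4) = q_form eps ip x1 x2 x3 x4"
proof -
  obtain A B where "g = kronecker A B" "det A = 1" "B \<in> special_orthogonal ip"
    using assms by (auto simp: G0ss_def)
  moreover have "bilinear_form ip"
    using ip by (simp add: nondegenerate_symmetric_form_def)
  ultimately show ?thesis
    using q_form_kronecker[OF eps] by blast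
qed

lemma tensor_map_Lambda0: "g \<in> G0ss ip \<Longrightarrow> x \<in> Lambda0 eps ip \<Longrightarrow> tensor_map g x \<in> Lambda0 eps ip"
  unfolding Lambda0_def
  by (rule tensor_map_primitive_ext_power) (auto simp: bilinear2_omega G0ss_omega)

lemma LGr_cone_subset_Lambda0: "LGr_cone eps ip \<subseteq> Lambda0 eps ip"
  unfolding LGr_cone_def Lambda0_def
  by (intro UN_least ext_power_isotropic_primitive bilinear2_omega) (auto simp: LGr_def)

text \<open>A left inverse makes \<open>g\<close> injective, so the dimension survives; isotropy
  survives because \<open>g\<close> preserves \<open>omega\<close>.\<close>

lemma LGr_image:
  assumes g: "g \<in> G0ss ip" and L: "L \<in> LGr eps ip"
  shows "(*v) g ` L \<in> LGr eps ip"
proof -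
  obtain h where h: "h ** g = mat 1" using G0ss_inverse[OF g] by blast
  have "inj ((*v) g)"
  proof (rule injI)
    fix x y assume "g *v x = g *v y"
    then have "h *v (g *v x) = h *v (g *v y)" by simp
    then show "x = y" by (simp add: matrix_vector_mul_assoc h)
  qed
  then have "vec.dim ((*v) g ` L) = vec.dim L"
    by (intro vec.dim_image_eq matrix_vector_mul_linear_gen) (erule inj_on_subset, simp)
  moreover have "vec.subspace ((*v) g ` L)"
    using L by (intro vec.subspace_image) (simp add: LGr_def)
  ultimately show ?thesis
    using L by (auto simp: LGr_def G0ss_omega[OF g])
qed

lemma tensor_map_LGr_cone:
  assumes "g \<in> G0ss ip" "x \<in> LGr_cone eps ip"
  shows "tensor_map g x \<in> LGr_cone eps ip"
proof -
  obtain L where L: "L \<in> LGr eps ip" "x \<in> ext_power CARD('n) L"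
    using assms(2) by (auto simp: LGr_cone_def)
  show ?thesis
    unfolding LGr_cone_def using LGr_image[OF assms(1) L(1)] tensor_map_ext_power[OF L(2), of g] by blast
qed

lemma qn_in_forms: "qn eps ip \<in> forms 4 (Lambda0 eps ip)"
  unfolding qn_def by (rule power_form_in_forms)

lemma form_action_qn:
  assumes "g \<in> G0ss ip"
  shows "form_action (Lambda0 eps ip) g (qn eps ip) = qn eps ip"
proof -
  obtain h where h: "h \<in> G0ss ip" "g ** h = mat 1" "h ** g = mat 1"
    using G0ss_inverse[OF assms] by blast
  then have "power_form CARD('n) (q_form eps ip) (tensor_map h x) (tensor_map h x) (tensor_map h x) (tensor_map h x) =
      power_form CARD('n) (q_form eps ip) x x x x" for x
    by (intro power_form_tensor_map multilinear4_q_form G0ss_q_form)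
  then show ?thesis
    using h by (auto simp: form_action_def qn_def matrix_inv_unique[OF h(2,3)] tensor_map_Lambda0 intro!: restrict_ext)
qed

lemma qn_class_in_R_part: "form_class eps ip 4 (qn eps ip) \<in> R_part eps ip 4"
  unfolding form_class_def R_part_def
  by (rule class_in_invariant_classes[OF qn_in_forms LGr_cone_subset_Lambda0 G0ss_inverse
      tensor_map_Lambda0 tensor_map_LGr_cone form_action_qn])

text \<open>A form lies in its own class; if that were the zero class, the form would vanish on the
  whole cone.\<close>

lemma qn_class_nonzero:
  assumes "x \<in> LGr_cone eps ip" "qn eps ip x \<noteq> 0"
  shows "form_class eps ip 4 (qn eps ip) \<noteq> zero_form_class eps ip 4"
proof
  assume eq: "form_class eps ip 4 (qn eps ip) = zero_form_class eps ip 4"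
  have x: "x \<in> Lambda0 eps ip" using assms LGr_cone_subset_Lambda0 by blast
  have "qn eps ip \<in> form_class eps ip 4 (qn eps ip)"
    using qn_in_forms LGr_cone_subset_Lambda0 forms_zero[of "Lambda0 eps ip" 4]
    by (auto simp: form_class_def congruent_forms_def vanishing_forms_def)
  then have "qn eps ip \<in> zero_form_class eps ip 4" by (simp only: eq)
  then have "(\<lambda>y\<in>Lambda0 eps ip. (\<lambda>x\<in>Lambda0 eps ip. 0) y - qn eps ip y) \<in> vanishing_forms 4 (Lambda0 eps ip) (LGr_cone eps ip)"
    by (simp add: zero_form_class_def form_class_def congruent_forms_def)
  then have "(\<lambda>y\<in>Lambda0 eps ip. (\<lambda>x\<in>Lambda0 eps ip. 0) y - qn eps ip y) x = 0"
    using assms(1) unfolding vanishing_forms_def by blast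
  then show False using x assms(2) by simp
qed

end


section \<open>A Lagrangian subspace with nonzero value\<close>

text \<open>The dual functionals read off the coefficients of a linear combination, which gives
  independence.\<close>

lemma dim_span_dual_family:
  fixes v :: "nat \<Rightarrow> complex^'a"
  assumes "\<And>i. i < k \<Longrightarrow> linear_coords (\<phi> i)"
    and "\<And>i j. i < k \<Longrightarrow> j < k \<Longrightarrow> \<phi> i (v j) = (if i = j then 1 else 0)"
  shows "vec.dim (vec.span (v ` {..<k})) = k"
proof -
  have inj: "inj_on v {..<k}"
  proof (rule inj_onI)
    fix i j assume "i \<in> {..<k}" "j \<in> {..<k}" "v i = v j"
    then show "i = j" using assms(2)[of i i] assms(2)[of i j] by (auto split: if_splits)
  qed
  have comb: "\<phi> i (\<Sum>j<k. c j *s v j) = c i" if i: "i < k" for c i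
  proof -
    have e: "\<phi> i x = (\<Sum>a\<in>UNIV. x $ a * \<phi> i (axis a 1))" for x
      using assms(1)[OF i] unfolding linear_coords_def by blast
    have "\<phi> i (\<Sum>j<k. c j *s v j) = (\<Sum>a\<in>UNIV. \<Sum>j<k. c j * (v j $ a * \<phi> i (axis a 1)))"
      by (subst e) (simp add: sum_distrib_left sum_distrib_right mult_ac)
    also have "\<dots> = (\<Sum>j<k. c j * \<phi> i (v j))"
      by (subst sum.swap) (simp only: sum_distrib_left[symmetric] e[symmetric])
    also have "\<dots> = (\<Sum>j<k. if i = j then c j else 0)"
      by (intro sum.cong) (auto simp: assms(2) i)
    finally show ?thesis using i by simp
  qed
  have "vec.independent (v ` {..<k})"
  proof (rule vec.independent_if_scalars_zero)
    fix f x assume 0: "(\<Sum>x\<in>v ` {..<k}. f x *s x) = 0" and "x \<in> v ` {..<k}"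
    then obtain i where i: "i < k" "x = v i" by auto
    have "(\<Sum>j<k. f (v j) *s v j) = 0"
      using 0 by (simp add: sum.reindex[OF inj])
    moreover have "\<phi> i 0 = 0"
      using comb[OF i(1), of "\<lambda>_. 0"] by simp
    ultimately show "f x = 0"
      using comb[OF i(1), of "\<lambda>j. f (v j)"] i by simp
  qed simp
  then show ?thesis
    by (simp add: vec.dim_eq_card_independent card_image[OF inj])
qed

text \<open>Up to the factor \<open>eps \<alpha> \<beta>\<^sup>2\<close>, the values of \<open>q_unsym\<close> on the vectors \<open>(\<alpha> + i \<beta>) \<otimes> e\<^sub>i\<close>.\<close>

definition pair_weight :: "nat \<Rightarrow> nat \<Rightarrow> nat \<Rightarrow> nat \<Rightarrow> real" where
  "pair_weight i j k l =
     (if i \<noteq> j \<and> (k = i \<and> l = j \<or> k = j \<and> l = i) then (real i - real j)\<^sup>2 else 0)"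

text \<open>The averaging is that of \<open>symmetrise4\<close>, kept real-valued so that positivity
  can be stated.\<close>

definition sym_pair_weight :: "nat \<Rightarrow> nat \<Rightarrow> nat \<Rightarrow> nat \<Rightarrow> real" where
  "sym_pair_weight i j k l = (\<Sum>\<pi> | \<pi> permutes {..<4::nat}.
     pair_weight ([i, j, k, l] ! \<pi> 0) ([i, j, k, l] ! \<pi> 1) ([i, j, k, l] ! \<pi> 2) ([i, j, k, l] ! \<pi> 3)) / fact 4"

lemma sym_pair_weight_nonneg: "0 \<le> sym_pair_weight i j k l"
  by (auto simp: sym_pair_weight_def pair_weight_def intro!: sum_nonneg divide_nonneg_nonneg)

lemma permutes_4_cases:
  fixes \<pi> :: "nat \<Rightarrow> nat"
  assumes "\<pi> permutes {..<4}"
  shows "\<pi> 0 < 4 \<and> \<pi> 1 < 4 \<and> \<pi> 2 < 4 \<and> \<pi> 3 < 4 \<and> distinct [\<pi> 0, \<pi> 1, \<pi> 2, \<pi> 3]"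
  using permutes_in_image[OF assms] permutes_inj[OF assms] by (simp add: inj_eq)

text \<open>Splitting into two distinct pairs does not depend on the order of the slots; all
  placements of the four positions are checked.\<close>

lemma paired_rearrange:
  fixes p0 p1 p2 p3 :: nat
  assumes p: "p0 < 4" "p1 < 4" "p2 < 4" "p3 < 4" "distinct [p0, p1, p2, p3]"
    and x: "x p0 \<noteq> x p1" "x p2 = x p0 \<and> x p3 = x p1 \<or> x p2 = x p1 \<and> x p3 = x p0"
  shows "paired (x 0) (x 1) (x 2) (x 3)"
proof -
  have lt4: "p = 0 \<or> p = 1 \<or> p = 2 \<or> p = 3" if "p < 4" for p :: nat
    using that by linarith
  show ?thesis
    using lt4[OF p(1)] lt4[OF p(2)] lt4[OF p(3)] lt4[OF p(4)] p(5) x unfolding paired_def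
    by (elim disjE) simp_all
qed

text \<open>A nonzero average has a nonzero summand, and its pair structure is carried back along
  the permutation.\<close>

lemma sym_pair_weight_paired:
  assumes "sym_pair_weight i j k l \<noteq> 0"
  shows "paired i j k l"
proof -
  let ?x = "\<lambda>m. [i, j, k, l] ! m"
  have "(\<Sum>\<pi> | \<pi> permutes {..<4::nat}.
      pair_weight (?x (\<pi> 0)) (?x (\<pi> 1)) (?x (\<pi> 2)) (?x (\<pi> 3))) \<noteq> 0"
    using assms unfolding sym_pair_weight_def by (metis div_0)
  then obtain \<pi> where \<pi>: "\<pi> permutes {..<4::nat}"
    and nz: "pair_weight (?x (\<pi> 0)) (?x (\<pi> 1)) (?x (\<pi> 2)) (?x (\<pi> 3)) \<noteq> 0"
    by (rule sum.not_neutral_contains_not_neutral) auto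
  have "?x (\<pi> 0) \<noteq> ?x (\<pi> 1)"
    "?x (\<pi> 2) = ?x (\<pi> 0) \<and> ?x (\<pi> 3) = ?x (\<pi> 1) \<or> ?x (\<pi> 2) = ?x (\<pi> 1) \<and> ?x (\<pi> 3) = ?x (\<pi> 0)"
    using nz by (auto simp only: pair_weight_def split: if_splits)
  then have "paired (?x 0) (?x 1) (?x 2) (?x 3)"
    using permutes_4_cases[OF \<pi>] by (intro paired_rearrange[of "\<pi> 0" "\<pi> 1" "\<pi> 2" "\<pi> 3" ?x]) blast+
  then show ?thesis by simp
qed

lemma sym_pair_weight_pos:
  assumes "i \<noteq> j"
  shows "0 < sym_pair_weight i i j j"
proof -
  let ?x = "\<lambda>m. [i, i, j, j] ! m"
  \<comment> \<open>Exchanging the middle slots turns \<open>i, i, j, j\<close> into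
    \<open>i, j, i, j\<close>, where \<open>pair_weight\<close> is a positive square; no other
    summand is negative.\<close>
  let ?t = "Transposition.transpose (1::nat) 2"
  have "?t permutes {..<4}" by (rule permutes_swap_id) auto
  moreover have "0 < pair_weight (?x (?t 0)) (?x (?t 1)) (?x (?t 2)) (?x (?t 3))"
    using assms by (simp add: pair_weight_def transpose_def)
  ultimately have "0 < (\<Sum>\<pi> | \<pi> permutes {..<4::nat}. pair_weight (?x (\<pi> 0)) (?x (\<pi> 1)) (?x (\<pi> 2)) (?x (\<pi> 3)))"
    by (intro sum_pos2[of _ ?t]) (auto simp: finite_permutations pair_weight_def)
  then show ?thesis by (simp add: sym_pair_weight_def)
qed

text \<open>The point is the wedge of the vectors \<open>v i\<close>; its value is a power of
  \<open>eps \<alpha> \<beta>\<close> times a real sum to which \<open>hyperdeterminant_pos\<close>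
  applies.\<close>

lemma qn_nonzero_on_LGr_cone:
  fixes eps :: "complex^2 \<Rightarrow> complex^2 \<Rightarrow> complex" and ip :: "complex^'n \<Rightarrow> complex^'n \<Rightarrow> complex"
  assumes n: "2 \<le> CARD('n)" and eps: "volume_form eps" and ip: "nondegenerate_symmetric_form ip"
  obtains x where "x \<in> LGr_cone eps ip" "qn eps ip x \<noteq> 0"
proof -
  let ?n = "CARD('n)"
  have b: "bilinear_form eps" "bilinear_form ip" and z: "\<And>x. eps x x = 0"
    using eps ip by (auto simp: volume_form_def nondegenerate_symmetric_form_def)
  note lin = bilinear_form_linear_simps[OF b(1)]
  obtain \<alpha> \<beta> where c: "eps \<alpha> \<beta> \<noteq> 0" using eps by (auto simp: volume_form_def)
  note alt = volume_form_skew[OF eps, of \<beta> \<alpha>]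
  obtain e :: "nat \<Rightarrow> complex^'n"
    where e: "\<And>i j. i < ?n \<Longrightarrow> j < ?n \<Longrightarrow> ip (e i) (e j) = (if i = j then 1 else 0)"
    using exists_orthonormal[OF ip, of ?n] by auto
  \<comment> \<open>With these multiples of \<open>\<beta>\<close>,
    \<open>eps (\<xi> i) (\<xi> j)\<close> is a real multiple of
    \<open>eps \<alpha> \<beta>\<close>, nonzero for distinct indices, so its square gives a
    positive weight.\<close>
  define \<xi> where "\<xi> i = \<alpha> + of_nat i *s \<beta>" for i :: nat
  define v where "v i = tensor_vec (\<xi> i) (e i)" for i
  have xi: "eps (\<xi> i) (\<xi> j) = of_real (real j - real i) * eps \<alpha> \<beta>" for i j
    by (simp add: \<xi>_def lin z alt algebra_simps)
  \<comment> \<open>For distinct indices the \<open>ip\<close> factor vanishes by orthogonality, for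
    equal ones the \<open>eps\<close> factor because it is alternating.\<close>
  have iso: "omega eps ip (v i) (v j) = 0" if "i < ?n" "j < ?n" for i j
    using that by (simp add: v_def omega_tensor_vec[OF b] e z)
  define L where "L = vec.span (v ` {..<?n})"
  have "vec.dim L = ?n"
    unfolding L_def
  proof (rule dim_span_dual_family)
    fix i assume "i < ?n"
    \<comment> \<open>Since \<open>eps (\<xi> j) \<beta> = eps \<alpha> \<beta>\<close> for every
      \<open>j\<close>, dividing by this value turns the pairing with
      \<open>tensor_vec \<beta> (e i)\<close> into the functional dual to
      \<open>v i\<close>.\<close>
    show "linear_coords (\<lambda>x. (1 / eps \<alpha> \<beta>) * omega eps ip x (tensor_vec \<beta> (e i)))"
      by (intro linear_coords_simps(1) bilinear2_linear_coords(1)[OF bilinear2_omega])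
    fix j assume "j < ?n"
    with \<open>i < ?n\<close> show "(1 / eps \<alpha> \<beta>) * omega eps ip (v j) (tensor_vec \<beta> (e i)) = (if i = j then 1 else 0)"
      using c by (simp add: v_def omega_tensor_vec[OF b] e \<xi>_def lin z)
  qed
  \<comment> \<open>Isotropy extends from the generators to their span one argument at a time, as
    kernels of linear functionals are subspaces.\<close>
  moreover have "omega eps ip x y = 0" if "x \<in> L" "y \<in> L" for x y
  proof -
    note om = bilinear2_linear_coords[OF bilinear2_omega, of eps ip]
    have ker: "vec.subspace {x. f x = 0}" if "linear_coords f" for f :: "complex^(2 \<times> 'n) \<Rightarrow> complex"
    proof -
      have f: "f x = (\<Sum>a\<in>UNIV. x $ a * f (axis a 1))" for x
        using that unfolding linear_coords_def by blast
      have "f 0 = 0" by (subst f) simp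
      moreover have "f (x + y) = f x + f y" for x y
        by (subst (1 2 3) f) (simp add: distrib_right sum.distrib)
      moreover have "f (c *s x) = c * f x" for c x
        by (subst (1 2) f) (simp add: sum_distrib_left mult.assoc)
      ultimately show ?thesis by (intro vec.subspaceI) auto
    qed
    have 1: "omega eps ip (v i) y = 0" if "i < ?n" for i
    proof -
      have "L \<subseteq> {y. omega eps ip (v i) y = 0}"
        unfolding L_def using iso that by (intro vec.span_minimal ker om) auto
      with \<open>y \<in> L\<close> show ?thesis by blast
    qed
    have "L \<subseteq> {x. omega eps ip x y = 0}"
      unfolding L_def using 1 by (intro vec.span_minimal ker om) auto
    with \<open>x \<in> L\<close> show ?thesis by blast
  qed
  ultimately have "L \<in> LGr eps ip"
    by (simp add: LGr_def L_def)
  moreover have "wedge ?n v \<in> ext_power ?n L"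
    unfolding ext_power_def L_def by (intro tensor.span_base CollectI exI[of _ v] conjI refl image_subsetI vec.span_base) auto
  ultimately have x: "wedge ?n v \<in> LGr_cone eps ip"
    unfolding LGr_cone_def by blast
  \<comment> \<open>Exchanging \<open>k\<close> and \<open>l\<close> changes the sign of the second
    \<open>eps\<close> factor and also of the bracket in \<open>ip\<close>, so both placements give
    the same square. For \<open>i = j\<close> the first \<open>eps\<close> factor is zero.\<close>
  have qu: "q_unsym eps ip (v i) (v j) (v k) (v l) = (eps \<alpha> \<beta>)\<^sup>2 * of_real (pair_weight i j k l)"
    if "i < ?n" "j < ?n" "k < ?n" "l < ?n" for i j k l
    using that by (auto simp: v_def q_unsym_tensor_vec[OF b] xi e pair_weight_def power2_eq_square algebra_simps)
  have qf: "q_form eps ip (v i) (v j) (v k) (v l) = (eps \<alpha> \<beta>)\<^sup>2 * of_real (sym_pair_weight i j k l)"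
    if "i < ?n" "j < ?n" "k < ?n" "l < ?n" for i j k l
  proof -
    let ?x = "\<lambda>m. [i, j, k, l] ! m"
    have lt: "?x m < ?n" if "m < 4" for m
      using that \<open>i < ?n\<close> \<open>j < ?n\<close> \<open>k < ?n\<close> \<open>l < ?n\<close> nth_mem[of m "[i, j, k, l]"] by auto
    have "q_form eps ip (v i) (v j) (v k) (v l) =
        (\<Sum>\<pi> | \<pi> permutes {..<4::nat}. q_unsym eps ip (v (?x (\<pi> 0))) (v (?x (\<pi> 1))) (v (?x (\<pi> 2))) (v (?x (\<pi> 3)))) / fact 4"
      unfolding q_form_def symmetrise4_map[of _ v] by (simp add: symmetrise4_def)
    also have "\<dots> = (\<Sum>\<pi> | \<pi> permutes {..<4::nat}. (eps \<alpha> \<beta>)\<^sup>2 *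
        of_real (pair_weight (?x (\<pi> 0)) (?x (\<pi> 1)) (?x (\<pi> 2)) (?x (\<pi> 3)))) / fact 4"
      using permutes_4_cases lt by (intro arg_cong2[where f = "(/)"] sum.cong refl qu) blast+
    finally show ?thesis
      by (simp add: sym_pair_weight_def sum_distrib_left)
  qed
  let ?P = "{s. s permutes {..<?n}}"
  have "power_form ?n (q_form eps ip) (wedge ?n v) (wedge ?n v) (wedge ?n v) (wedge ?n v) =
      (\<Sum>s1\<in>?P. \<Sum>s2\<in>?P. \<Sum>s3\<in>?P. \<Sum>s4\<in>?P. of_int (sign s1 * sign s2 * sign s3 * sign s4) *
        (\<Prod>i<?n. q_form eps ip (v (s1 i)) (v (s2 i)) (v (s3 i)) (v (s4 i))))"
    by (rule power_form_wedge) (rule multilinear4_expand[OF multilinear4_q_form])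
  also have "\<dots> = (\<Sum>s1\<in>?P. \<Sum>s2\<in>?P. \<Sum>s3\<in>?P. \<Sum>s4\<in>?P. (eps \<alpha> \<beta>)\<^sup>2 ^ ?n *
      of_real (of_int (sign s1 * sign s2 * sign s3 * sign s4) *
        (\<Prod>i<?n. sym_pair_weight (s1 i) (s2 i) (s3 i) (s4 i))))"
  proof (intro sum.cong refl)
    fix s1 s2 s3 s4 assume "s1 \<in> ?P" "s2 \<in> ?P" "s3 \<in> ?P" "s4 \<in> ?P"
    then have "(\<Prod>i<?n. q_form eps ip (v (s1 i)) (v (s2 i)) (v (s3 i)) (v (s4 i))) =
        (\<Prod>i<?n. (eps \<alpha> \<beta>)\<^sup>2 * of_real (sym_pair_weight (s1 i) (s2 i) (s3 i) (s4 i)))"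
      using permutes_in_image[of _ "{..<?n}"] by (intro prod.cong refl qf) auto
    then show "of_int (sign s1 * sign s2 * sign s3 * sign s4) *
        (\<Prod>i<?n. q_form eps ip (v (s1 i)) (v (s2 i)) (v (s3 i)) (v (s4 i))) =
      (eps \<alpha> \<beta>)\<^sup>2 ^ ?n * of_real (of_int (sign s1 * sign s2 * sign s3 * sign s4) *
        (\<Prod>i<?n. sym_pair_weight (s1 i) (s2 i) (s3 i) (s4 i)))"
      by (simp add: prod.distrib mult_ac)
  qed
  \<comment> \<open>With the common power of \<open>eps \<alpha> \<beta>\<close> taken out, the
    remaining sum is real, and its positivity excludes zero.\<close>
  also have "\<dots> = (eps \<alpha> \<beta>)\<^sup>2 ^ ?n * of_real (\<Sum>s1\<in>?P. \<Sum>s2\<in>?P. \<Sum>s3\<in>?P. \<Sum>s4\<in>?P.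
      of_int (sign s1 * sign s2 * sign s3 * sign s4) *
        (\<Prod>i<?n. sym_pair_weight (s1 i) (s2 i) (s3 i) (s4 i)))"
    by (simp only: sum_distrib_left of_real_sum)
  also have "\<dots> \<noteq> 0"
    using c less_imp_neq[OF hyperdeterminant_pos[where r = sym_pair_weight, OF n sym_pair_weight_nonneg
      sym_pair_weight_paired sym_pair_weight_pos]]
    by (simp only: mult_eq_0_iff of_real_eq_0_iff power_eq_0_iff) simp
  finally have "qn eps ip (wedge ?n v) \<noteq> 0"
    using x LGr_cone_subset_Lambda0[OF eps ip] by (auto simp: qn_def)
  with x show thesis by (rule that)
qed

theorem proposition6:
  fixes eps :: "complex^2 \<Rightarrow> complex^2 \<Rightarrow> complex"
    and ip :: "complex^'n \<Rightarrow> complex^'n \<Rightarrow> complex"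
  assumes "3 \<le> CARD('n)"
    and "volume_form eps"
    and "nondegenerate_symmetric_form ip"
  shows "(\<forall>g\<in>G0ss ip. form_action (Lambda0 eps ip) g (qn eps ip) = qn eps ip) \<and>
    form_class eps ip 4 (qn eps ip) \<in> R_part eps ip 4 - {zero_form_class eps ip 4}"
proof -
  \<comment> \<open>One point of the cone with nonzero value separates the class from the zero
    class.\<close>
  obtain x where "x \<in> LGr_cone eps ip" "qn eps ip x \<noteq> 0"
    using qn_nonzero_on_LGr_cone[OF _ assms(2,3)] assms(1) by (metis Suc_leD numeral_2_eq_2 numeral_3_eq_3)
  then show ?thesis
    using assms(2,3) by (simp add: form_action_qn qn_class_in_R_part qn_class_nonzero)
qed

end
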